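(* Let $k\ge 1$ and let $\Phi$ (fine-grid time-stepping operator) and $\Psi$ (coarse-grid time-stepping operator) be time-independent linear operators given by $n\times n$ matrices. Let $\mathcal{R}_F$ and $\mathcal{R}_{FCF}$ be the residual-propagation operators of two-level MGRIT with $N_c$ coarse-grid time points, coarsening factor $k$, and F-relaxation, respectively FCF-relaxation, as defined in the context. Define $$\mathcal{W}_F:=\Big(\sum_{\ell=0}^{k-1}\Phi^\ell(\Phi^\ell)^*\Big)^{1/2},\qquad \mathcal{W}_{FCF}:=\Big(\sum_{\ell=k}^{2k-1}\Phi^\ell(\Phi^\ell)^*\Big)^{1/2},$$ and assume, in the FCF case, that $\mathcal{W}_{FCF}$ is invertible. Then there exist positive functions $\varepsilon_F(N_c)=O(1/\sqrt{N_c})$ and $\varepsilon_{FCF}(N_c)=O(1/\sqrt{N_c})$ as $N_c\to\infty$ (with $\Phi,\Psi,k$ fixed) such that the following holds for all $N_c\ge 3$. Let $\widehat{\varphi}_F$ and $\widehat{\varphi}_{FCF}$ be the minimum nonnegative constants such that, for all vectors $\mathbf{v}\in\mathbb{C}^n$, $$\|(\Psi-\Phi^k)\mathbf{v}\|\le\widehat{\varphi}_F\Big[\min_{x\in[0,2\pi]}\big\|\mathcal{W}_F^{-1}(I-e^{\mathrm{i}x}\Psi)\mathbf{v}\big\|+\varepsilon_F(N_c)\|\mathbf{v}\|\Big],$$ $$\|(\Psi-\Phi^k)\mathbf{v}\|\le\widehat{\varphi}_{FCF}\Big[\min_{x\in[0,2\pi]}\big\|\mathcal{W}_{FCF}^{-1}(I-e^{\mathrm{i}x}\Psi)\mathbf{v}\big\|+\varepsilon_{FCF}(N_c)\|\mathbf{v}\|\Big].$$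 Then $\|\mathcal{R}_F\|\ge\widehat{\varphi}_F$ and $\|\mathcal{R}_{FCF}\|\ge\widehat{\varphi}_{FCF}$.
   Context: $\|\cdot\|$ is the $\ell^2$ vector norm and the induced operator norm; $(\cdot)^{1/2}$ is the positive semidefinite square root. Two-level MGRIT. Take $N=(N_c-1)k+1$ time points $0,1,\dots,N-1$ and let $A$ be the $N\times N$ block lower bidiagonal space-time matrix with $n\times n$ identity blocks on the diagonal, $-\Phi$ in every block of the first subdiagonal, and zero elsewhere. Time points $0,k,2k,\dots,(N_c-1)k$ are C-points; all others are F-points. After reordering with F-points first, $A$ is partitioned as $\begin{bmatrix} A_{ff} & A_{fc} \\ A_{cf} & A_{cc} \end{bmatrix}$. Let $A_\Delta$ (the Schur complement of $A$ on C-points) and $B_\Delta$ be the $N_c\times N_c$ block lower bidiagonal matrices with identity diagonal blocks and with every first-subdiagonal block equal to $-\Phi^k$, respectively $-\Psi$. The residual-propagation operators of one iteration are $$\mathcal{R}_F=\begin{bmatrix}\mathbf{0} \\ I-A_\Delta B_\Delta^{-1}\end{bmatrix}\begin{bmatrix}-A_{cf}A_{ff}^{-1}&I\end{bmatrix},\qquad \mathcal{R}_{FCF}=\begin{bmatrix}\mathbf{0} \\ (I-A_\Delta B_\Delta^{-1})(I-A_\Delta)\end{bmatrix}\begin{bmatrix}-A_{cf}A_{ff}^{-1}&I\end{bmatrix}.$$ *)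

theory Defs
  imports
    "HOL-Analysis.L2_Norm"
    "HOL-Library.Landau_Symbols"
    "Jordan_Normal_Form.DL_Submatrix"
    "Jordan_Normal_Form.Gauss_Jordan_Elimination"
    "Jordan_Normal_Form.Schur_Decomposition"
begin

section \<open>Norms, inverses and square roots of complex matrices\<close>

definition vec_l2norm :: "complex vec \<Rightarrow> real" where
  "vec_l2norm v = L2_set (\<lambda>i. cmod (v $ i)) {..<dim_vec v}"

definition mat_opnorm :: "complex mat \<Rightarrow> real" where
  "mat_opnorm M =
     Sup {vec_l2norm (M *\<^sub>v v) | v. v \<in> carrier_vec (dim_col M) \<and> vec_l2norm v \<le> 1}"

text \<open>Unspecified if the argument is not an invertible square matrix.\<close>

definition mat_inv :: "complex mat \<Rightarrow> complex mat" where
  "mat_inv M = the (mat_inverse M)"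

text \<open>The order on \<^typ>\<open>complex\<close> is the one of \<^theory>\<open>HOL-Library.Complex_Order\<close>:
  \<open>0 \<le> z\<close> means that \<open>z\<close> is real and nonnegative.\<close>

definition psd_mat :: "nat \<Rightarrow> complex mat \<Rightarrow> bool" where
  "psd_mat n M \<longleftrightarrow> M \<in> carrier_mat n n \<and> mat_adjoint M = M \<and>
     (\<forall>v \<in> carrier_vec n. 0 \<le> (M *\<^sub>v v) \<bullet>c v)"

definition psd_sqrt :: "complex mat \<Rightarrow> complex mat" where
  "psd_sqrt M = (THE S. psd_mat (dim_row M) S \<and> S * S = M)"

definition append_cols :: "complex mat \<Rightarrow> complex mat \<Rightarrow> complex mat" where
  "append_cols A B = four_block_mat A B (0\<^sub>m 0 (dim_col A)) (0\<^sub>m 0 (dim_col B))"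


section \<open>Two-level MGRIT\<close>

text \<open>The \<open>m \<times> m\<close> block matrix with \<open>n \<times> n\<close> blocks that has identities on the block diagonal and
  \<open>-X\<close> on the first block subdiagonal.  Row (column) \<open>r\<close> is component \<open>r mod n\<close> of
  block row (column) \<open>r div n\<close>.\<close>

definition block_bidiag :: "nat \<Rightarrow> nat \<Rightarrow> complex mat \<Rightarrow> complex mat" where
  "block_bidiag m n X = mat (m * n) (m * n) (\<lambda>(r, s).
     if r div n = s div n then 1\<^sub>m n $$ (r mod n, s mod n)
     else if r div n = s div n + 1 then (- X) $$ (r mod n, s mod n)
     else 0)"

definition num_points :: "nat \<Rightarrow> nat \<Rightarrow> nat" where
  "num_points Nc k = (Nc - 1) * k + 1"

definition C_dofs :: "nat \<Rightarrow> nat \<Rightarrow> nat set" where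
  "C_dofs n k = {r. k dvd r div n}"

definition F_dofs :: "nat \<Rightarrow> nat \<Rightarrow> nat set" where
  "F_dofs n k = {r. \<not> k dvd r div n}"

text \<open>In the definitions below, \<open>n\<close> is the spatial dimension, \<open>Nc\<close> the number of C-points and
  \<open>k\<close> the coarsening factor; \<open>\<Phi>\<close> and \<open>\<Psi>\<close> are the fine- and coarse-grid time-stepping operators.
  \<^const>\<open>submatrix\<close> keeps the selected indices in increasing order, so that \<open>A_ff\<close> and \<open>A_cf\<close> are
  the blocks of the space-time matrix after reordering it with F-points first.\<close>

definition A_ff :: "nat \<Rightarrow> nat \<Rightarrow> nat \<Rightarrow> complex mat \<Rightarrow> complex mat" where
  "A_ff n Nc k \<Phi> =
     submatrix (block_bidiag (num_points Nc k) n \<Phi>) (F_dofs n k) (F_dofs n k)"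

definition A_cf :: "nat \<Rightarrow> nat \<Rightarrow> nat \<Rightarrow> complex mat \<Rightarrow> complex mat" where
  "A_cf n Nc k \<Phi> =
     submatrix (block_bidiag (num_points Nc k) n \<Phi>) (C_dofs n k) (F_dofs n k)"

definition A_Delta :: "nat \<Rightarrow> nat \<Rightarrow> nat \<Rightarrow> complex mat \<Rightarrow> complex mat" where
  "A_Delta n Nc k \<Phi> = block_bidiag Nc n (\<Phi> ^\<^sub>m k)"

definition B_Delta :: "nat \<Rightarrow> nat \<Rightarrow> complex mat \<Rightarrow> complex mat" where
  "B_Delta n Nc \<Psi> = block_bidiag Nc n \<Psi>"

definition coarse_error :: "nat \<Rightarrow> nat \<Rightarrow> nat \<Rightarrow> complex mat \<Rightarrow> complex mat \<Rightarrow> complex mat" where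
  "coarse_error n Nc k \<Phi> \<Psi> = 1\<^sub>m (Nc * n) - A_Delta n Nc k \<Phi> * mat_inv (B_Delta n Nc \<Psi>)"

definition residual_restriction :: "nat \<Rightarrow> nat \<Rightarrow> nat \<Rightarrow> complex mat \<Rightarrow> complex mat" where
  "residual_restriction n Nc k \<Phi> =
     append_cols (- (A_cf n Nc k \<Phi> * mat_inv (A_ff n Nc k \<Phi>))) (1\<^sub>m (Nc * n))"

definition R_F :: "nat \<Rightarrow> nat \<Rightarrow> nat \<Rightarrow> complex mat \<Rightarrow> complex mat \<Rightarrow> complex mat" where
  "R_F n Nc k \<Phi> \<Psi> =
     (0\<^sub>m (dim_row (A_ff n Nc k \<Phi>)) (Nc * n) @\<^sub>r coarse_error n Nc k \<Phi> \<Psi>)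
       * residual_restriction n Nc k \<Phi>"

definition R_FCF :: "nat \<Rightarrow> nat \<Rightarrow> nat \<Rightarrow> complex mat \<Rightarrow> complex mat \<Rightarrow> complex mat" where
  "R_FCF n Nc k \<Phi> \<Psi> =
     (0\<^sub>m (dim_row (A_ff n Nc k \<Phi>)) (Nc * n)
        @\<^sub>r (coarse_error n Nc k \<Phi> \<Psi> * (1\<^sub>m (Nc * n) - A_Delta n Nc k \<Phi>)))
       * residual_restriction n Nc k \<Phi>"


section \<open>Temporal approximation property\<close>

text \<open>The matrix \<open>\<Sum>\<ell>\<in>L. \<Phi>\<^sup>\<ell> (\<Phi>\<^sup>\<ell>)\<^sup>*\<close>, written entrywise because matrices of
  unconstrained size do not form an additive monoid.\<close>

definition power_gram :: "complex mat \<Rightarrow> nat set \<Rightarrow> complex mat" where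
  "power_gram \<Phi> L = mat (dim_row \<Phi>) (dim_row \<Phi>)
     (\<lambda>(i, j). \<Sum>l\<in>L. (\<Phi> ^\<^sub>m l * mat_adjoint (\<Phi> ^\<^sub>m l)) $$ (i, j))"

definition W_F :: "nat \<Rightarrow> complex mat \<Rightarrow> complex mat" where
  "W_F k \<Phi> = psd_sqrt (power_gram \<Phi> {0..<k})"

definition W_FCF :: "nat \<Rightarrow> complex mat \<Rightarrow> complex mat" where
  "W_FCF k \<Phi> = psd_sqrt (power_gram \<Phi> {k..<2 * k})"

definition shifted_norm ::
  "nat \<Rightarrow> complex mat \<Rightarrow> complex mat \<Rightarrow> complex vec \<Rightarrow> real \<Rightarrow> real" where
  "shifted_norm n W \<Psi> v x =
     vec_l2norm (mat_inv W *\<^sub>v ((1\<^sub>m n - exp (\<i> * complex_of_real x) \<cdot>\<^sub>m \<Psi>) *\<^sub>v v))"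

text \<open>The infimum over \<open>[0, 2\<pi>]\<close> is attained; see \<open>min_shifted_norm_attained\<close> below.\<close>

definition min_shifted_norm ::
  "nat \<Rightarrow> complex mat \<Rightarrow> complex mat \<Rightarrow> complex vec \<Rightarrow> real" where
  "min_shifted_norm n W \<Psi> v = (INF x \<in> {0..2 * pi}. shifted_norm n W \<Psi> v x)"

definition tap_constants ::
  "nat \<Rightarrow> nat \<Rightarrow> complex mat \<Rightarrow> complex mat \<Rightarrow> complex mat \<Rightarrow> real \<Rightarrow> real set" where
  "tap_constants n k W \<Phi> \<Psi> e = {c. 0 \<le> c \<and>
     (\<forall>v \<in> carrier_vec n. vec_l2norm ((\<Psi> - \<Phi> ^\<^sub>m k) *\<^sub>v v)
        \<le> c * (min_shifted_norm n W \<Psi> v + e * vec_l2norm v))}"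

definition is_minimum :: "real \<Rightarrow> real set \<Rightarrow> bool" where
  "is_minimum c S \<longleftrightarrow> c \<in> S \<and> (\<forall>c' \<in> S. c \<le> c')"

lemma min_shifted_norm_attained:
  assumes W: "mat_inv W \<in> carrier_mat n n" and P: "\<Psi> \<in> carrier_mat n n"
    and v: "v \<in> carrier_vec n"
  shows "\<exists>x \<in> {0..2 * pi}. shifted_norm n W \<Psi> v x = min_shifted_norm n W \<Psi> v \<and>
    (\<forall>y \<in> {0..2 * pi}. shifted_norm n W \<Psi> v x \<le> shifted_norm n W \<Psi> v y)"
proof -
  have form: "shifted_norm n W \<Psi> v x =
    L2_set (\<lambda>i. cmod (\<Sum>j<n. mat_inv W $$ (i, j) *
      (\<Sum>l<n. (1\<^sub>m n $$ (j, l) - exp (\<i> * complex_of_real x) * \<Psi> $$ (j, l)) * v $ l))) {..<n}" for x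
    unfolding shifted_norm_def vec_l2norm_def
    using W P v
    by (intro L2_set_cong)
       (auto simp: scalar_prod_def lessThan_atLeast0 intro!: arg_cong[where f = cmod] sum.cong)
  have "continuous_on {0..2 * pi} (shifted_norm n W \<Psi> v)"
    unfolding form[abs_def] L2_set_def by (intro continuous_intros)
  then obtain x where x: "x \<in> {0..2 * pi}"
    "\<forall>y \<in> {0..2 * pi}. shifted_norm n W \<Psi> v x \<le> shifted_norm n W \<Psi> v y"
    using continuous_attains_inf[of "{0..2 * pi}" "shifted_norm n W \<Psi> v"] by auto
  have "min_shifted_norm n W \<Psi> v = shifted_norm n W \<Psi> v x"
    unfolding min_shifted_norm_def using x by (intro cInf_eq_minimum) auto
  with x show ?thesis by metis
qed

end

theory Submission
  imports Defs "Jordan_Normal_Form.Spectral_Radius" "HOL-Analysis.Elementary_Metric_Spaces"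
begin

text \<open>For a vector \<open>v\<close> and a phase \<open>x\<close> take the coarse correction \<open>e\<^sub>j = exp (-\<i>jx) v\<close>.  Then
  \<open>B_Delta e\<close> has blocks \<open>exp (-\<i>jx) (I - exp (\<i>x) \<Psi>) v\<close> for \<open>j \<ge> 1\<close>, and \<open>I - A_Delta B_Delta\<^sup>-\<^sup>1\<close>
  maps \<open>B_Delta e\<close> to \<open>(B_Delta - A_Delta) e\<close>, whose blocks have norm \<open>\<parallel>(\<Psi> - \<Phi>\<^sup>k) v\<parallel>\<close>.  The least-norm
  residual whose restriction to the C-points is \<open>B_Delta e\<close> costs \<open>\<parallel>W\<^sup>-\<^sup>1 (I - exp (\<i>x) \<Psi>) v\<parallel>\<^sup>2\<close> per
  block, except for one initial block costing \<open>O(\<parallel>v\<parallel>\<^sup>2)\<close>.  Dividing by the number of blocks leaves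
  the term \<open>\<epsilon>(Nc) \<parallel>v\<parallel>\<close> with \<open>\<epsilon>(Nc) = O(1 / sqrt Nc)\<close>.  For FCF-relaxation the same works with
  \<open>e\<^sub>0 = 0\<close>, and the last block of the residual is not needed.\<close>

section \<open>Complex vectors and adjoints\<close>

text \<open>Phases have modulus one, so all blocks after the first cost the same and all nonzero
  output blocks have the same norm; this is what makes averaging over blocks lossless. Between two
  C-points the restriction sends the fine residuals \<rho>_t, t < k, to the sum of \<Phi>^(k-1-t)
  \<rho>_t. The Gram matrix of this map is G = \<open>power_gram \<Phi> {0..<k}\<close>, so the
  least-norm preimage of y is \<rho>_t = adj(\<Phi>^(k-1-t)) G^-1 y, with squared norm <G^-1 y, y>:
  here \<open>W_F\<close> enters. In the FCF case \<open>I - A_Delta\<close> is \<Phi>^k times a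
  block shift, so G is replaced by \<Phi>^k G adj(\<Phi>^k), the square of \<open>W_FCF\<close>. The
  shift has zero first output block, which forces \<open>e 0 = 0\<close>, and it discards the last
  input block; hence Nc - 2 intervals are paid for and Nc - 2 blocks are gained. The initial block
  must be a preimage of a multiple of v under \<Phi>^k, whose size is a constant depending on \<Phi>
  and k. The factor 2 / sqrt (Nc + 1) comes from 4 (Nc - 2) \<ge> Nc + 1, which is equivalent to Nc
  \<ge> 3.\<close>

lemma mat_adjoint_dim [simp]:
  "dim_row (mat_adjoint A) = dim_col A" "dim_col (mat_adjoint A) = dim_row A"
  by (auto simp: mat_adjoint_def)

lemma mat_adjoint_carrier [simp]:
  "A \<in> carrier_mat m n \<Longrightarrow> mat_adjoint A \<in> carrier_mat n m"
  by (intro carrier_matI) auto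

lemma mat_adjoint_index [simp]:
  "i < dim_col A \<Longrightarrow> j < dim_row A \<Longrightarrow> mat_adjoint A $$ (i, j) = conjugate (A $$ (j, i))"
  unfolding mat_adjoint_def by (simp add: mat_of_rows_index)

lemma mat_adjoint_mat_adjoint [simp]: "mat_adjoint (mat_adjoint A) = (A :: complex mat)"
  by (intro eq_matI) auto

lemma mat_adjoint_one [simp]: "mat_adjoint (1\<^sub>m n) = (1\<^sub>m n :: complex mat)"
  by (intro eq_matI) auto

lemma mat_adjoint_mult:
  fixes A B :: "complex mat"
  assumes "A \<in> carrier_mat m n" "B \<in> carrier_mat n l"
  shows "mat_adjoint (A * B) = mat_adjoint B * mat_adjoint A"
  using assms by (intro eq_matI) (auto simp: scalar_prod_def sum_conjugate mult.commute)

lemma mat_adjoint_minus: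
  fixes A B :: "complex mat"
  assumes "A \<in> carrier_mat m n" "B \<in> carrier_mat m n"
  shows "mat_adjoint (A - B) = mat_adjoint A - mat_adjoint B"
  using assms by (intro eq_matI) auto

lemma index_mult_mat_vec_sum:
  assumes "A \<in> carrier_mat m n" "v \<in> carrier_vec n" "i < m"
  shows "(A *\<^sub>v v) $ i = (\<Sum>j<n. A $$ (i, j) * v $ j)"
  using assms by (auto simp: scalar_prod_def lessThan_atLeast0 intro!: sum.cong)

lemma cscalar_mult_mat_vec:
  fixes A :: "complex mat"
  assumes "A \<in> carrier_mat m n" "v \<in> carrier_vec n" "w \<in> carrier_vec m"
  shows "(A *\<^sub>v v) \<bullet>c w = v \<bullet>c (mat_adjoint A *\<^sub>v w)"
proof -
  have "(A *\<^sub>v v) \<bullet>c w = (\<Sum>i<m. \<Sum>j<n. A $$ (i, j) * v $ j * cnj (w $ i))"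
    using assms by (simp add: scalar_prod_def lessThan_atLeast0 sum_distrib_right)
  also have "\<dots> = (\<Sum>j<n. \<Sum>i<m. A $$ (i, j) * v $ j * cnj (w $ i))"
    by (rule sum.swap)
  also have "\<dots> = v \<bullet>c (mat_adjoint A *\<^sub>v w)"
    using assms by (auto simp: scalar_prod_def lessThan_atLeast0 sum_distrib_left
        intro!: sum.cong)
  finally show ?thesis .
qed

lemma vec_l2norm_nonneg [simp]: "0 \<le> vec_l2norm v"
  by (simp add: vec_l2norm_def)

lemma vec_l2norm_power2: "(vec_l2norm v)\<^sup>2 = (\<Sum>i<dim_vec v. (cmod (v $ i))\<^sup>2)"
  by (simp add: vec_l2norm_def L2_set_def sum_nonneg)

lemma cscalar_self: "v \<bullet>c v = complex_of_real ((vec_l2norm v)\<^sup>2)"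
  unfolding vec_l2norm_power2
  by (simp add: scalar_prod_def lessThan_atLeast0 complex_norm_square del: of_real_power)

lemma vec_l2norm_zero [simp]: "vec_l2norm (0\<^sub>v n) = 0"
  by (simp add: vec_l2norm_def L2_set_def)

lemma vec_l2norm_eq_0:
  assumes "v \<in> carrier_vec n" "vec_l2norm v = 0"
  shows "v = 0\<^sub>v n"
  using assms by (intro eq_vecI) (auto simp: vec_l2norm_def L2_set_eq_0_iff)

lemma vec_l2norm_smult: "vec_l2norm (c \<cdot>\<^sub>v v) = cmod c * vec_l2norm v"
proof -
  have "vec_l2norm (c \<cdot>\<^sub>v v) = L2_set (\<lambda>i. cmod c * cmod (v $ i)) {..<dim_vec v}"
    unfolding vec_l2norm_def by (auto simp: norm_mult intro!: L2_set_cong)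
  then show ?thesis by (simp add: vec_l2norm_def L2_set_right_distrib)
qed

lemma vec_l2norm_append_power2:
  "(vec_l2norm (v @\<^sub>v w))\<^sup>2 = (vec_l2norm v)\<^sup>2 + (vec_l2norm w)\<^sup>2"
proof -
  have "{..<dim_vec v + dim_vec w} = {..<dim_vec v} \<union> (+) (dim_vec v) ` {..<dim_vec w}"
    by (auto simp: lessThan_atLeast0 add.commute)
  then have "(vec_l2norm (v @\<^sub>v w))\<^sup>2 =
      (\<Sum>i\<in>{..<dim_vec v} \<union> (+) (dim_vec v) ` {..<dim_vec w}. (cmod ((v @\<^sub>v w) $ i))\<^sup>2)"
    by (simp add: vec_l2norm_power2)
  also have "\<dots> = (\<Sum>i<dim_vec v. (cmod ((v @\<^sub>v w) $ i))\<^sup>2) +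
      (\<Sum>i\<in>(+) (dim_vec v) ` {..<dim_vec w}. (cmod ((v @\<^sub>v w) $ i))\<^sup>2)"
    by (intro sum.union_disjoint) auto
  also have "\<dots> = (vec_l2norm v)\<^sup>2 + (vec_l2norm w)\<^sup>2"
    by (auto simp: vec_l2norm_power2 sum.reindex intro!: arg_cong2[where f = "(+)"] sum.cong)
  finally show ?thesis .
qed

lemma vec_l2norm_zero_append [simp]: "vec_l2norm (0\<^sub>v m @\<^sub>v w) = vec_l2norm w"
  using vec_l2norm_append_power2[of "0\<^sub>v m" w] by simp

section \<open>The operator norm\<close>

text \<open>Makes the set in \<open>mat_opnorm\<close> bounded above, without which its
  \<open>Sup\<close> carries no information. It also supplies the constant for the initial block in
  the FCF case.\<close>

lemma mult_mat_vec_bounded: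
  fixes M :: "complex mat"
  shows "\<exists>K. \<forall>v \<in> carrier_vec (dim_col M). vec_l2norm (M *\<^sub>v v) \<le> K * vec_l2norm v"
proof -
  define K where "K = (\<Sum>i<dim_row M. \<Sum>j<dim_col M. cmod (M $$ (i, j)))"
  have "vec_l2norm (M *\<^sub>v v) \<le> K * vec_l2norm v" if v: "v \<in> carrier_vec (dim_col M)" for v
  proof -
    have entry: "cmod (v $ j) \<le> vec_l2norm v" if "j < dim_col M" for j
      using v that unfolding vec_l2norm_def by (intro member_le_L2_set) auto
    have "vec_l2norm (M *\<^sub>v v) \<le> (\<Sum>i<dim_row M. cmod ((M *\<^sub>v v) $ i))"
      unfolding vec_l2norm_def dim_mult_mat_vec by (rule L2_set_le_sum) auto
    also have "\<dots> \<le> (\<Sum>i<dim_row M. \<Sum>j<dim_col M. cmod (M $$ (i, j)) * vec_l2norm v)"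
    proof (intro sum_mono)
      fix i assume i: "i \<in> {..<dim_row M}"
      have "cmod ((M *\<^sub>v v) $ i) = cmod (\<Sum>j<dim_col M. M $$ (i, j) * v $ j)"
        using index_mult_mat_vec_sum[of M "dim_row M" "dim_col M" v i] v i by auto
      also have "\<dots> \<le> (\<Sum>j<dim_col M. cmod (M $$ (i, j)) * cmod (v $ j))"
        using norm_sum[of "\<lambda>j. M $$ (i, j) * v $ j" "{..<dim_col M}"] by (simp add: norm_mult)
      also have "\<dots> \<le> (\<Sum>j<dim_col M. cmod (M $$ (i, j)) * vec_l2norm v)"
        by (intro sum_mono mult_left_mono entry) auto
      finally show "cmod ((M *\<^sub>v v) $ i) \<le> (\<Sum>j<dim_col M. cmod (M $$ (i, j)) * vec_l2norm v)" .
    qed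
    also have "\<dots> = K * vec_l2norm v"
      by (simp add: K_def sum_distrib_right)
    finally show ?thesis .
  qed
  then show ?thesis by blast
qed

lemma mat_opnorm_upper:
  assumes v: "v \<in> carrier_vec (dim_col M)" "vec_l2norm v \<le> 1"
  shows "vec_l2norm (M *\<^sub>v v) \<le> mat_opnorm M"
proof -
  obtain K where K: "\<forall>v \<in> carrier_vec (dim_col M). vec_l2norm (M *\<^sub>v v) \<le> K * vec_l2norm v"
    using mult_mat_vec_bounded by blast
  have "bdd_above {vec_l2norm (M *\<^sub>v v) | v. v \<in> carrier_vec (dim_col M) \<and> vec_l2norm v \<le> 1}"
  proof (intro bdd_aboveI)
    fix y assume "y \<in> {vec_l2norm (M *\<^sub>v v) | v. v \<in> carrier_vec (dim_col M) \<and> vec_l2norm v \<le> 1}"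
    then obtain v where v: "v \<in> carrier_vec (dim_col M)" "vec_l2norm v \<le> 1" "y = vec_l2norm (M *\<^sub>v v)"
      by blast
    \<comment> \<open>The sign of the obtained \<open>K\<close> is unknown, hence the absolute
      value.\<close>
    have "K * vec_l2norm v \<le> \<bar>K\<bar> * 1"
      using v by (intro mult_mono) auto
    then show "y \<le> \<bar>K\<bar>" using K v by fastforce
  qed
  then show ?thesis
    unfolding mat_opnorm_def using v by (intro cSup_upper) auto
qed

lemma mat_opnorm_nonneg: "0 \<le> mat_opnorm M"
proof -
  have "vec_l2norm (M *\<^sub>v 0\<^sub>v (dim_col M)) \<le> mat_opnorm M"
    by (rule mat_opnorm_upper) auto
  then show ?thesis using vec_l2norm_nonneg by (rule order_trans[rotated])
qed

lemma vec_l2norm_mult_mat_vec_le: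
  assumes v: "v \<in> carrier_vec (dim_col M)"
  shows "vec_l2norm (M *\<^sub>v v) \<le> mat_opnorm M * vec_l2norm v"
proof (cases "vec_l2norm v = 0")
  case True
  then have "v = 0\<^sub>v (dim_col M)" using v vec_l2norm_eq_0 by blast
  then have "M *\<^sub>v v = 0\<^sub>v (dim_row M)" by (intro eq_vecI) auto
  then show ?thesis using True by simp
next
  case False
  then have pos: "vec_l2norm v > 0" using vec_l2norm_nonneg[of v] by linarith
  define c where "c = complex_of_real (1 / vec_l2norm v)"
  have c: "cmod c = 1 / vec_l2norm v" using pos by (simp add: c_def norm_divide)
  have "vec_l2norm (M *\<^sub>v (c \<cdot>\<^sub>v v)) \<le> mat_opnorm M"
    using v pos by (intro mat_opnorm_upper) (auto simp: vec_l2norm_smult c)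
  also have "M *\<^sub>v (c \<cdot>\<^sub>v v) = c \<cdot>\<^sub>v (M *\<^sub>v v)"
    using v by (intro mult_mat_vec) auto
  finally show ?thesis
    using pos by (simp add: vec_l2norm_smult c field_simps)
qed

section \<open>The spectral theorem and positive semidefinite square roots\<close>

text \<open>Real diagonal entries make self-adjointness automatic and allow the real
  \<open>sqrt\<close> to be applied to eigenvalues.\<close>

definition real_diag :: "nat \<Rightarrow> (nat \<Rightarrow> real) \<Rightarrow> complex mat" where
  "real_diag n d = mat n n (\<lambda>(i, j). if i = j then complex_of_real (d i) else 0)"

lemma real_diag_carrier [simp]: "real_diag n d \<in> carrier_mat n n"
  by (simp add: real_diag_def)

lemma real_diag_dim [simp]: "dim_row (real_diag n d) = n" "dim_col (real_diag n d) = n"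
  by (simp_all add: real_diag_def)

lemma mat_adjoint_real_diag [simp]: "mat_adjoint (real_diag n d) = real_diag n d"
  by (intro eq_matI) (auto simp: real_diag_def)

lemma real_diag_mult: "real_diag n d * real_diag n e = real_diag n (\<lambda>i. d i * e i)"
  by (intro eq_matI) (auto simp: real_diag_def scalar_prod_def if_distrib cong: if_cong)

lemma real_diag_mult_vec:
  assumes "v \<in> carrier_vec n"
  shows "real_diag n d *\<^sub>v v = vec n (\<lambda>i. complex_of_real (d i) * v $ i)"
proof (intro eq_vecI)
  fix i assume "i < dim_vec (vec n (\<lambda>i. complex_of_real (d i) * v $ i))"
  then have i: "i < n" by simp
  have "(real_diag n d *\<^sub>v v) $ i = (\<Sum>j<n. real_diag n d $$ (i, j) * v $ j)"
    using assms i by (intro index_mult_mat_vec_sum) auto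
  also have "\<dots> = (\<Sum>j<n. if i = j then complex_of_real (d i) * v $ j else 0)"
    using i by (intro sum.cong) (auto simp: real_diag_def)
  finally have "(real_diag n d *\<^sub>v v) $ i =
    (\<Sum>j<n. if i = j then complex_of_real (d i) * v $ j else 0)" .
  then show "(real_diag n d *\<^sub>v v) $ i = vec n (\<lambda>i. complex_of_real (d i) * v $ i) $ i"
    using i by simp
qed simp

lemma complex_eigenvector_exists:
  fixes A :: "complex mat"
  assumes A: "A \<in> carrier_mat n n" and n: "n > 0"
  shows "\<exists>e v. v \<in> carrier_vec n \<and> v \<noteq> 0\<^sub>v n \<and> A *\<^sub>v v = e \<cdot>\<^sub>v v"
proof -
  obtain e where "eigenvalue A e"
    using spectrum_non_empty[OF A n] by (auto simp: spectrum_def)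
  then show ?thesis using A by (auto simp: eigenvalue_def eigenvector_def)
qed

text \<open>Gram-Schmidt keeps the first vector of a basis that starts with \<open>v\<close>, so
  after normalisation the first column is still parallel to \<open>v\<close>.\<close>

lemma unitary_completion:
  fixes v :: "complex vec"
  assumes v: "v \<in> carrier_vec n" and v0: "v \<noteq> 0\<^sub>v n"
  shows "\<exists>U c. U \<in> carrier_mat n n \<and> mat_adjoint U * U = 1\<^sub>m n \<and> col U 0 = c \<cdot>\<^sub>v v"
proof -
  interpret cof_vec_space n "TYPE(complex)" .
  have n: "n > 0" using v v0 by (cases n) auto
  define b where "b = basis_completion v"
  define ws where "ws = gram_schmidt n b"
  from basis_completion[OF v v0, folded b_def]
  have dist_b: "distinct b" and indep: "\<not> lin_dep (set b)" and b: "set b \<subseteq> carrier_vec n"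
    and hdb: "hd b = v" and len_b: "length b = n" by auto
  from hdb len_b n obtain vs where bv: "b = v # vs" by (cases b) auto
  from gram_schmidt_result[OF b dist_b indep refl, folded ws_def]
  have ws: "set ws \<subseteq> carrier_vec n" and orth: "corthogonal ws" and len: "length ws = n"
    by (auto simp: len_b)
  from gram_schmidt_hd[OF v, of vs, folded bv] have "hd ws = v" unfolding ws_def .
  then have ws0: "ws ! 0 = v" using len n by (subst (asm) hd_conv_nth) auto
  \<comment> \<open>\<open>gram_schmidt\<close> orthogonalises without normalising; these factors
    scale the columns to length one.\<close>
  define s where "s i = complex_of_real (1 / vec_l2norm (ws ! i))" for i
  define U where "U = mat_of_cols n (map (\<lambda>i. s i \<cdot>\<^sub>v ws ! i) [0..<n])"
  have wsc: "ws ! i \<in> carrier_vec n" if "i < n" for i using ws len that by auto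
  have U: "U \<in> carrier_mat n n" by (simp add: U_def carrier_matI)
  have col: "col U i = s i \<cdot>\<^sub>v ws ! i" if "i < n" for i
    unfolding U_def using that wsc by (subst col_mat_of_cols) auto
  have "mat_adjoint U * U = 1\<^sub>m n"
  proof (intro eq_matI)
    fix i j assume "i < dim_row (1\<^sub>m n :: complex mat)" "j < dim_col (1\<^sub>m n :: complex mat)"
    then have i: "i < n" and j: "j < n" by auto
    have "(mat_adjoint U * U) $$ (i, j) = (\<Sum>l<n. cnj (U $$ (l, i)) * U $$ (l, j))"
      using U i j by (simp add: scalar_prod_def lessThan_atLeast0)
    also have "\<dots> = col U j \<bullet>c col U i"
      using U i j by (auto simp: scalar_prod_def lessThan_atLeast0 intro!: sum.cong)
    also have "\<dots> = s j * cnj (s i) * (ws ! j \<bullet>c ws ! i)"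
      using wsc[OF i] wsc[OF j] by (simp add: col i j conjugate_smult_vec)
    also have "\<dots> = (1\<^sub>m n) $$ (i, j)"
    proof (cases "i = j")
      case False
      then show ?thesis using corthogonalD[OF orth, of j i] i j len by simp
    next
      case True
      have "ws ! i \<bullet>c ws ! i \<noteq> 0" using corthogonalD[OF orth, of i i] i len by simp
      then have "vec_l2norm (ws ! i) \<noteq> 0" by (auto simp: cscalar_self)
      then show ?thesis using True i by (simp add: s_def cscalar_self power2_eq_square)
    qed
    finally show "(mat_adjoint U * U) $$ (i, j) = 1\<^sub>m n $$ (i, j)" .
  qed (use U in auto)
  moreover have "col U 0 = s 0 \<cdot>\<^sub>v v" using col[of 0] n ws0 by simp
  ultimately show ?thesis using U by blast
qed

text \<open>If the first column of \<open>U\<close> is an eigenvector, the first column of adj(U) H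
  U is a multiple of the first unit vector. Self-adjointness copies these zeros to the first row and
  forces the eigenvalue to be real.\<close>

lemma hermitian_deflation:
  fixes H :: "complex mat"
  assumes H: "H \<in> carrier_mat (Suc m) (Suc m)" "mat_adjoint H = H"
  shows "\<exists>U a H'. U \<in> carrier_mat (Suc m) (Suc m) \<and> mat_adjoint U * U = 1\<^sub>m (Suc m) \<and>
    H' \<in> carrier_mat m m \<and> mat_adjoint H' = H' \<and>
    mat_adjoint U * H * U =
      four_block_mat (real_diag 1 (\<lambda>_. a)) (0\<^sub>m 1 m) (0\<^sub>m m 1) H'"
proof -
  obtain e v where v: "v \<in> carrier_vec (Suc m)" "v \<noteq> 0\<^sub>v (Suc m)" and ev: "H *\<^sub>v v = e \<cdot>\<^sub>v v"
    using complex_eigenvector_exists[OF H(1)] by auto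
  obtain U c where U: "U \<in> carrier_mat (Suc m) (Suc m)" and UU: "mat_adjoint U * U = 1\<^sub>m (Suc m)"
    and U0: "col U 0 = c \<cdot>\<^sub>v v"
    using unitary_completion[OF v] by blast
  define K where "K = mat_adjoint U * H * U"
  have K: "K \<in> carrier_mat (Suc m) (Suc m)" using U H by (auto simp: K_def)
  note assoc = assoc_mult_mat[of _ "Suc m" "Suc m" _ "Suc m" _ "Suc m"]
    mult_carrier_mat[of _ "Suc m" "Suc m" _ "Suc m"]
  have KH: "mat_adjoint K = K"
    unfolding K_def using U H
    by (simp add: mat_adjoint_mult[of _ "Suc m" "Suc m" _ "Suc m"] assoc)
  have HU0: "H *\<^sub>v col U 0 = e \<cdot>\<^sub>v col U 0"
    unfolding U0 using v H ev by (simp add: mult_mat_vec[OF H(1)] smult_smult_assoc mult.commute)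
  have "K *\<^sub>v unit_vec (Suc m) 0 = mat_adjoint U *\<^sub>v (H *\<^sub>v (U *\<^sub>v unit_vec (Suc m) 0))"
    unfolding K_def using U H
    by (simp add: assoc assoc_mult_mat_vec[of _ "Suc m" "Suc m" _ "Suc m"])
  also have "U *\<^sub>v unit_vec (Suc m) 0 = col U 0"
    using U by (intro eq_vecI) auto
  also have "mat_adjoint U *\<^sub>v (H *\<^sub>v col U 0) = e \<cdot>\<^sub>v (mat_adjoint U *\<^sub>v col U 0)"
    unfolding HU0 using U by (intro mult_mat_vec) auto
  also have "mat_adjoint U *\<^sub>v col U 0 = col (mat_adjoint U * U) 0"
    using U by (simp add: col_mult2[of _ "Suc m" "Suc m" _ "Suc m"])
  also have "\<dots> = unit_vec (Suc m) 0" unfolding UU by simp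
  finally have Ke: "K *\<^sub>v unit_vec (Suc m) 0 = e \<cdot>\<^sub>v unit_vec (Suc m) 0" .
  have col0: "K $$ (i, 0) = (if i = 0 then e else 0)" if "i < Suc m" for i
  proof -
    have "K $$ (i, 0) = (K *\<^sub>v unit_vec (Suc m) 0) $ i" using K that by simp
    also have "\<dots> = (if i = 0 then e else 0)" unfolding Ke using that by (simp add: unit_vec_def)
    finally show ?thesis .
  qed
  have herm: "K $$ (i, j) = cnj (K $$ (j, i))" if "i < Suc m" "j < Suc m" for i j
  proof -
    have "mat_adjoint K $$ (i, j) = cnj (K $$ (j, i))" using K that by auto
    then show ?thesis using KH by simp
  qed
  have row0: "K $$ (0, i) = (if i = 0 then cnj e else 0)" if "i < Suc m" for i
    using herm[of 0 i] col0[of i] that by auto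
  have ce: "cnj e = e" using col0[of 0] row0[of 0] by simp
  then have e: "e = complex_of_real (Re e)" by (simp add: complex_eq_iff)
  define H' where "H' = mat m m (\<lambda>(i, j). K $$ (Suc i, Suc j))"
  have "mat_adjoint H' = H'"
    by (intro eq_matI) (auto simp: H'_def intro: herm[symmetric])
  moreover have "K = four_block_mat (real_diag 1 (\<lambda>_. Re e)) (0\<^sub>m 1 m) (0\<^sub>m m 1) H'"
    using K e[symmetric] by (intro eq_matI) (auto simp: H'_def real_diag_def col0 row0 ce)
  moreover have "H' \<in> carrier_mat m m" by (simp add: H'_def)
  ultimately show ?thesis using U UU unfolding K_def by blast
qed

theorem hermitian_spectral_decomposition:
  fixes H :: "complex mat"
  assumes "H \<in> carrier_mat n n" "mat_adjoint H = H"
  shows "\<exists>U d. U \<in> carrier_mat n n \<and> mat_adjoint U * U = 1\<^sub>m n \<and> U * mat_adjoint U = 1\<^sub>m n \<and>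
    H = U * real_diag n d * mat_adjoint U"
  using assms
proof (induction n arbitrary: H)
  case 0
  then show ?case by (intro exI[of _ "1\<^sub>m 0"] exI) (auto intro!: eq_matI)
next
  case (Suc m)
  note H = Suc.prems
  obtain U a H' where U: "U \<in> carrier_mat (Suc m) (Suc m)" and UU: "mat_adjoint U * U = 1\<^sub>m (Suc m)"
    and H': "H' \<in> carrier_mat m m" "mat_adjoint H' = H'"
    and K: "mat_adjoint U * H * U =
      four_block_mat (real_diag 1 (\<lambda>_. a)) (0\<^sub>m 1 m) (0\<^sub>m m 1) H'"
    using hermitian_deflation[OF H] by blast
  obtain V d where V: "V \<in> carrier_mat m m" and VV: "mat_adjoint V * V = 1\<^sub>m m"
    "V * mat_adjoint V = 1\<^sub>m m" and dec: "H' = V * real_diag m d * mat_adjoint V"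
    using Suc.IH[OF H'] by blast
  have UU': "U * mat_adjoint U = 1\<^sub>m (Suc m)"
    using mat_mult_left_right_inverse[OF _ _ UU] U by simp
  \<comment> \<open>Extends the unitary of the trailing block by an identity entry, so that it
    leaves the eigenvalue already split off untouched.\<close>
  define X where "X = four_block_mat (1\<^sub>m 1) (0\<^sub>m 1 m) (0\<^sub>m m 1) V"
  have X: "X \<in> carrier_mat (Suc m) (Suc m)"
    using four_block_carrier_mat[of "1\<^sub>m 1" 1 1 V m m] V by (simp add: X_def)
  have Xa: "mat_adjoint X = four_block_mat (1\<^sub>m 1) (0\<^sub>m 1 m) (0\<^sub>m m 1) (mat_adjoint V)"
    using V by (intro eq_matI) (auto simp: X_def)
  have XX: "mat_adjoint X * X = 1\<^sub>m (Suc m)"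
    unfolding Xa unfolding X_def
    by (subst mult_four_block_mat[of _ 1 1 _ m _ m _ _ 1 _ m])
      (use V VV four_block_one_mat[of 1 m] in auto)
  have XX': "X * mat_adjoint X = 1\<^sub>m (Suc m)"
    using mat_mult_left_right_inverse[OF _ _ XX] X by simp
  define d' where "d' i = (if i = 0 then a else d (i - 1))" for i
  have D: "real_diag (Suc m) d' =
      four_block_mat (real_diag 1 (\<lambda>_. a)) (0\<^sub>m 1 m) (0\<^sub>m m 1) (real_diag m d)"
    by (intro eq_matI) (auto simp: real_diag_def d'_def)
  let ?E = "real_diag 1 (\<lambda>_. a)" and ?D = "real_diag m d"
  have "X * real_diag (Suc m) d' = four_block_mat ?E (0\<^sub>m 1 m) (0\<^sub>m m 1) (V * ?D)"
    unfolding X_def D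
    by (subst mult_four_block_mat[of _ 1 1 _ m _ m _ _ 1 _ m]) (use V in auto)
  then have "X * real_diag (Suc m) d' * mat_adjoint X =
      four_block_mat ?E (0\<^sub>m 1 m) (0\<^sub>m m 1) (V * ?D) * mat_adjoint X" by simp
  also have "\<dots> = four_block_mat ?E (0\<^sub>m 1 m) (0\<^sub>m m 1) H'"
    unfolding Xa
    by (subst mult_four_block_mat[of _ 1 1 _ m _ m _ _ 1 _ m])
      (use V mult_carrier_mat[OF V real_diag_carrier] in \<open>auto simp: dec\<close>)
  finally have XDX: "X * real_diag (Suc m) d' * mat_adjoint X = mat_adjoint U * H * U"
    unfolding K .
  define Z where "Z = U * X"
  have Z: "Z \<in> carrier_mat (Suc m) (Suc m)" using U X by (auto simp: Z_def)
  have Za: "mat_adjoint Z = mat_adjoint X * mat_adjoint U"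
    unfolding Z_def using U X by (rule mat_adjoint_mult)
  note assoc = assoc_mult_mat[of _ "Suc m" "Suc m" _ "Suc m" _ "Suc m"]
    mult_carrier_mat[of _ "Suc m" "Suc m" _ "Suc m"]
  have carr: "mat_adjoint U \<in> carrier_mat (Suc m) (Suc m)"
    "mat_adjoint X \<in> carrier_mat (Suc m) (Suc m)" using U X by auto
  have "mat_adjoint Z * Z = mat_adjoint X * ((mat_adjoint U * U) * X)"
    unfolding Za unfolding Z_def using U X carr by (simp add: assoc)
  then have ZZ: "mat_adjoint Z * Z = 1\<^sub>m (Suc m)" using X carr XX by (simp add: UU)
  have ZZ': "Z * mat_adjoint Z = 1\<^sub>m (Suc m)"
    using mat_mult_left_right_inverse[OF _ _ ZZ] Z by simp
  have "Z * real_diag (Suc m) d' * mat_adjoint Z =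
      U * (X * real_diag (Suc m) d' * mat_adjoint X) * mat_adjoint U"
    unfolding Za unfolding Z_def using U X carr by (simp add: assoc)
  also have "\<dots> = (U * mat_adjoint U) * H * (U * mat_adjoint U)"
    unfolding XDX using U H carr by (simp add: assoc)
  also have "\<dots> = H" unfolding UU' using H by simp
  finally show ?case using Z ZZ ZZ' by metis
qed

text \<open>Semidefiniteness makes the eigenvalues nonnegative, so their square roots can be taken
  in the same eigenbasis.\<close>

lemma psd_sqrt_exists:
  assumes G: "psd_mat n G"
  shows "\<exists>S. psd_mat n S \<and> S * S = G"
proof -
  have Gc: "G \<in> carrier_mat n n" and Ga: "mat_adjoint G = G"
    and Gp: "\<And>v. v \<in> carrier_vec n \<Longrightarrow> 0 \<le> (G *\<^sub>v v) \<bullet>c v"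
    using G by (auto simp: psd_mat_def)
  obtain U d where U: "U \<in> carrier_mat n n" and UU: "mat_adjoint U * U = 1\<^sub>m n"
    "U * mat_adjoint U = 1\<^sub>m n" and dec: "G = U * real_diag n d * mat_adjoint U"
    using hermitian_spectral_decomposition[OF Gc Ga] by blast
  have Ua: "mat_adjoint U \<in> carrier_mat n n" using U by simp
  note assoc = assoc_mult_mat[of _ n n _ n _ n] mult_carrier_mat[of _ n n _ n]
    and assocv = assoc_mult_mat_vec[of _ n n _ n] mult_carrier_mat[of _ n n _ n]
      mult_mat_vec_carrier[of _ n n]
    and assocv' = assoc_mult_mat_vec[of _ n n _ n, symmetric]
  have quad: "((U * real_diag n f * mat_adjoint U) *\<^sub>v v) \<bullet>c v =
      (real_diag n f *\<^sub>v (mat_adjoint U *\<^sub>v v)) \<bullet>c (mat_adjoint U *\<^sub>v v)"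
    if v: "v \<in> carrier_vec n" for v f
  proof -
    have "(U * real_diag n f * mat_adjoint U) *\<^sub>v v = U *\<^sub>v (real_diag n f *\<^sub>v (mat_adjoint U *\<^sub>v v))"
      using U Ua v by (simp add: assocv)
    then show ?thesis using U Ua v
      by (simp add: cscalar_mult_mat_vec[OF U mult_mat_vec_carrier[OF real_diag_carrier mult_mat_vec_carrier[OF Ua v]] v])
  qed
  have d: "0 \<le> d i" if i: "i < n" for i
  proof -
    \<comment> \<open>On the i-th eigenvector the quadratic form of \<open>G\<close> equals
      \<open>d i\<close>.\<close>
    define u where "u = U *\<^sub>v unit_vec n i"
    have u: "u \<in> carrier_vec n" using U by (simp add: u_def)
    have Uu: "mat_adjoint U *\<^sub>v u = unit_vec n i"
      unfolding u_def using U Ua UU by (simp add: assocv' del: assoc_mult_mat_vec)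
    have "0 \<le> (G *\<^sub>v u) \<bullet>c u" by (rule Gp[OF u])
    also have "\<dots> = (real_diag n d *\<^sub>v unit_vec n i) \<bullet>c unit_vec n i"
      unfolding dec by (simp add: quad[OF u] Uu)
    also have "\<dots> = (\<Sum>j = 0..<n. complex_of_real (d j) * unit_vec n i $ j * cnj (unit_vec n i $ j))"
      using i by (simp add: real_diag_mult_vec scalar_prod_def)
    also have "\<dots> = (\<Sum>j = 0..<n. if j = i then complex_of_real (d i) else 0)"
      using i by (intro sum.cong) auto
    also have "\<dots> = complex_of_real (d i)" using i by simp
    finally show ?thesis by (simp add: less_eq_complex_def)
  qed
  define S where "S = U * real_diag n (\<lambda>i. sqrt (d i)) * mat_adjoint U"
  let ?R = "real_diag n (\<lambda>i. sqrt (d i))"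
  have S: "S \<in> carrier_mat n n" using U by (auto simp: S_def)
  have RR: "?R * ?R = real_diag n d"
    unfolding real_diag_mult using d by (intro eq_matI) (auto simp: real_diag_def simp flip: of_real_mult)
  have "S * S = U * (?R * ((mat_adjoint U * U) * (?R * mat_adjoint U)))"
    unfolding S_def using U Ua by (simp add: assoc)
  also have "\<dots> = U * (?R * ?R) * mat_adjoint U"
    unfolding UU using U Ua
    by (simp add: assoc left_mult_one_mat[OF mult_carrier_mat[OF real_diag_carrier Ua]])
  finally have SS: "S * S = G" unfolding RR dec .
  have "mat_adjoint S = S"
    unfolding S_def using U Ua by (simp add: mat_adjoint_mult[of _ n n _ n] assoc)
  moreover have "0 \<le> (S *\<^sub>v v) \<bullet>c v" if v: "v \<in> carrier_vec n" for v
  proof -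
    define y where "y = mat_adjoint U *\<^sub>v v"
    have y: "y \<in> carrier_vec n" using Ua v by (simp add: y_def)
    have "(S *\<^sub>v v) \<bullet>c v = (\<Sum>i<n. complex_of_real (sqrt (d i)) * y $ i * cnj (y $ i))"
      unfolding S_def quad[OF v] y_def[symmetric] real_diag_mult_vec[OF y]
      using y by (auto simp: scalar_prod_def lessThan_atLeast0)
    also have "\<dots> = complex_of_real (\<Sum>i<n. sqrt (d i) * (cmod (y $ i))\<^sup>2)"
      by (simp add: complex_norm_square mult.assoc del: of_real_power)
    finally show ?thesis using d by (auto simp: less_eq_complex_def intro!: sum_nonneg)
  qed
  ultimately show ?thesis using S SS by (auto simp: psd_mat_def)
qed

text \<open>With \<open>D = S - T\<close>, equality of the squares says \<open>S D + D T = 0\<close>; on an eigenvector of \<open>D\<close>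
  this forces the eigenvalue to vanish.\<close>

lemma psd_sqrt_unique:
  assumes S: "psd_mat n S" and T: "psd_mat n T" and eq: "S * S = T * T"
  shows "S = T"
proof -
  have Sc: "S \<in> carrier_mat n n" and Tc: "T \<in> carrier_mat n n"
    using S T by (auto simp: psd_mat_def)
  define D where "D = S - T"
  have Dc: "D \<in> carrier_mat n n" using Sc Tc by (simp add: D_def minus_carrier_mat)
  have Da: "mat_adjoint D = D"
    unfolding D_def mat_adjoint_minus[OF Sc Tc] using S T by (simp add: psd_mat_def)
  obtain U d where U: "U \<in> carrier_mat n n" and UU: "mat_adjoint U * U = 1\<^sub>m n"
    and dec: "D = U * real_diag n d * mat_adjoint U"
    using hermitian_spectral_decomposition[OF Dc Da] by blast
  have Ua: "mat_adjoint U \<in> carrier_mat n n" using U by simp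
  note assocv = assoc_mult_mat_vec[of _ n n _ n] mult_carrier_mat[of _ n n _ n]
      mult_mat_vec_carrier[of _ n n]
    and assocv' = assoc_mult_mat_vec[of _ n n _ n, symmetric]
  have d: "d i = 0" if i: "i < n" for i
  proof (rule ccontr)
    assume d0: "d i \<noteq> 0"
    define u where "u = U *\<^sub>v unit_vec n i"
    have u: "u \<in> carrier_vec n" using U by (simp add: u_def)
    have Uu: "mat_adjoint U *\<^sub>v u = unit_vec n i"
      unfolding u_def using U Ua UU by (simp add: assocv' del: assoc_mult_mat_vec)
    have "D *\<^sub>v u = U *\<^sub>v (real_diag n d *\<^sub>v unit_vec n i)"
      unfolding dec using U Ua u by (simp add: assocv Uu)
    also have "real_diag n d *\<^sub>v unit_vec n i = complex_of_real (d i) \<cdot>\<^sub>v unit_vec n i"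
      using i by (intro eq_vecI) (auto simp: real_diag_mult_vec unit_vec_def)
    also have "U *\<^sub>v (complex_of_real (d i) \<cdot>\<^sub>v unit_vec n i) = complex_of_real (d i) \<cdot>\<^sub>v u"
      unfolding u_def using U by (intro mult_mat_vec) auto
    finally have Du: "D *\<^sub>v u = complex_of_real (d i) \<cdot>\<^sub>v u" .
    have Su: "S *\<^sub>v u \<in> carrier_vec n" and Tu: "T *\<^sub>v u \<in> carrier_vec n"
      using Sc Tc u by auto
    have Du': "D *\<^sub>v u = S *\<^sub>v u - T *\<^sub>v u"
      unfolding D_def using Sc Tc u by (rule minus_mult_distrib_mat_vec)
    have adj: "mat_adjoint S = S" "mat_adjoint T = T" using S T by (auto simp: psd_mat_def)
    have "(S *\<^sub>v u) \<bullet>c (S *\<^sub>v u) = ((S * S) *\<^sub>v u) \<bullet>c u"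
      using cscalar_mult_mat_vec[OF Sc Su u] Sc u by (simp add: adj assocv)
    moreover have "(T *\<^sub>v u) \<bullet>c (T *\<^sub>v u) = ((T * T) *\<^sub>v u) \<bullet>c u"
      using cscalar_mult_mat_vec[OF Tc Tu u] Tc u by (simp add: adj assocv)
    ultimately have norms: "(S *\<^sub>v u) \<bullet>c (S *\<^sub>v u) = (T *\<^sub>v u) \<bullet>c (T *\<^sub>v u)" by (simp add: eq)
    \<comment> \<open>Scalar-product form of S (S - T) + (S - T) T = S^2 - T^2, paired with
      \<open>u\<close> on both sides.\<close>
    have diff: "p \<bullet>c (p - q) + (p - q) \<bullet>c q = p \<bullet>c p - q \<bullet>c q"
      if "p \<in> carrier_vec n" "q \<in> carrier_vec n" for p q :: "complex vec"
      using that by (simp add: scalar_prod_def algebra_simps sum.distrib sum_subtractf)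
    have "(S *\<^sub>v u) \<bullet>c (D *\<^sub>v u) + (D *\<^sub>v u) \<bullet>c (T *\<^sub>v u) =
        (S *\<^sub>v u) \<bullet>c (S *\<^sub>v u) - (T *\<^sub>v u) \<bullet>c (T *\<^sub>v u)"
      unfolding Du' by (rule diff[OF Su Tu])
    then have "(S *\<^sub>v u) \<bullet>c (D *\<^sub>v u) + (D *\<^sub>v u) \<bullet>c (T *\<^sub>v u) = 0" using norms by simp
    moreover have "(S *\<^sub>v u) \<bullet>c (D *\<^sub>v u) = d i * ((S *\<^sub>v u) \<bullet>c u)"
      unfolding Du using u Su by (simp add: conjugate_smult_vec)
    moreover have "(D *\<^sub>v u) \<bullet>c (T *\<^sub>v u) = d i * ((T *\<^sub>v u) \<bullet>c u)"
      using cscalar_mult_mat_vec[OF Tc u u] unfolding Du adj using u Tu by simp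
    ultimately have "complex_of_real (d i) * ((S *\<^sub>v u) \<bullet>c u + (T *\<^sub>v u) \<bullet>c u) = 0"
      by (simp add: algebra_simps)
    then have zero: "(S *\<^sub>v u) \<bullet>c u + (T *\<^sub>v u) \<bullet>c u = 0" using d0 by simp
    \<comment> \<open>Two nonnegative numbers with sum zero both vanish, and so does their
      difference <D u, u> = d |u|^2, which leaves \<open>u = 0\<close>.\<close>
    have "0 \<le> (S *\<^sub>v u) \<bullet>c u" "0 \<le> (T *\<^sub>v u) \<bullet>c u" using S T u by (auto simp: psd_mat_def)
    then have "(S *\<^sub>v u) \<bullet>c u = 0" "(T *\<^sub>v u) \<bullet>c u = 0"
      using zero by (auto simp: less_eq_complex_def complex_eq_iff)
    moreover have "(p - q) \<bullet>c u = p \<bullet>c u - q \<bullet>c u"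
      if "p \<in> carrier_vec n" "q \<in> carrier_vec n" for p q :: "complex vec"
      using that u by (simp add: scalar_prod_def algebra_simps sum_subtractf)
    then have "(D *\<^sub>v u) \<bullet>c u = (S *\<^sub>v u) \<bullet>c u - (T *\<^sub>v u) \<bullet>c u"
      unfolding Du' using Su Tu by blast
    ultimately have "complex_of_real (d i) * (u \<bullet>c u) = 0"
      unfolding Du using u by simp
    then have "u \<bullet>c u = 0" using d0 by simp
    then have "u = 0\<^sub>v n" using u by (simp add: conjugate_square_eq_0_vec)
    moreover have "mat_adjoint U *\<^sub>v 0\<^sub>v n = 0\<^sub>v n" using Ua
      by (intro eq_vecI) (auto simp: scalar_prod_def)
    ultimately have "unit_vec n i = (0\<^sub>v n :: complex vec)" using Uu by simp
    then show False using i by (metis index_unit_vec(1) index_zero_vec(1) zero_neq_one)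
  qed
  have "real_diag n d = 0\<^sub>m n n" using d by (intro eq_matI) (auto simp: real_diag_def)
  then have "D = 0\<^sub>m n n" unfolding dec using U Ua by simp
  then have "S $$ (i, j) - T $$ (i, j) = 0" if "i < n" "j < n" for i j
    using that Sc Tc unfolding D_def
    by (metis carrier_matD index_minus_mat(1) index_zero_mat(1))
  then show ?thesis using Sc Tc by (intro eq_matI) auto
qed

text \<open>Existence together with uniqueness is what gives the definite description in
  \<open>psd_sqrt\<close> a meaning; from here on only these two properties of the root are
  used.\<close>

lemma psd_sqrt_psd:
  assumes "psd_mat n G"
  shows "psd_mat n (psd_sqrt G)" "psd_sqrt G * psd_sqrt G = G"
proof -
  have n: "dim_row G = n" using assms by (auto simp: psd_mat_def)
  have "\<exists>!S. psd_mat n S \<and> S * S = G"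
    using psd_sqrt_exists[OF assms] psd_sqrt_unique by blast
  then have "psd_mat n (psd_sqrt G) \<and> psd_sqrt G * psd_sqrt G = G"
    unfolding psd_sqrt_def n by (rule theI')
  then show "psd_mat n (psd_sqrt G)" "psd_sqrt G * psd_sqrt G = G" by auto
qed

text \<open>The single access to \<open>mat_inv\<close>: all inverses below are justified by a
  nonzero determinant, which for the space-time matrices is the 1 of a unit triangular
  matrix.\<close>

lemma mat_inv_det_nonzero:
  assumes A: "A \<in> carrier_mat n n" and det: "det A \<noteq> 0"
  shows "mat_inv A \<in> carrier_mat n n" "A * mat_inv A = 1\<^sub>m n" "mat_inv A * A = 1\<^sub>m n"
proof -
  obtain B where "mat_inverse A = Some B"
    using mat_inverse(1)[OF A, of "()"] det_non_zero_imp_unit[OF A det, of "()"] by (metis not_None_eq)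
  then show "mat_inv A \<in> carrier_mat n n" "A * mat_inv A = 1\<^sub>m n" "mat_inv A * A = 1\<^sub>m n"
    using mat_inverse(2)[OF A] by (auto simp: mat_inv_def)
qed

lemma mat_inv_mult_mat_vec_cancel:
  assumes A: "A \<in> carrier_mat n n" "det A \<noteq> 0" and v: "v \<in> carrier_vec n"
  shows "mat_inv A *\<^sub>v (A *\<^sub>v v) = v" "A *\<^sub>v (mat_inv A *\<^sub>v v) = v"
  using mat_inv_det_nonzero[OF A] A v
  by (simp_all add: assoc_mult_mat_vec[of _ n n _ n, symmetric] del: assoc_mult_mat_vec)

section \<open>Block vectors\<close>

text \<open>Follows the \<open>div\<close>/\<open>mod\<close> indexing of
  \<open>block_bidiag\<close>. Taking the blocks from a total function lets neighbouring blocks be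
  mentioned without range conditions.\<close>

definition block_vec :: "nat \<Rightarrow> nat \<Rightarrow> (nat \<Rightarrow> complex vec) \<Rightarrow> complex vec" where
  "block_vec m n g = vec (m * n) (\<lambda>i. g (i div n) $ (i mod n))"

lemma block_vec_dim [simp]: "dim_vec (block_vec m n g) = m * n"
  by (simp add: block_vec_def)

lemma block_vec_carrier [simp]: "block_vec m n g \<in> carrier_vec (m * n)"
  by (simp add: carrier_vecI)

lemma block_vec_cong: "(\<And>j. j < m \<Longrightarrow> g j = h j) \<Longrightarrow> block_vec m n g = block_vec m n h"
  unfolding block_vec_def by (intro eq_vecI) (auto simp: less_mult_imp_div_less)

lemma block_index_less: "b < m \<Longrightarrow> c < n \<Longrightarrow> b * n + c < m * (n :: nat)"
proof -
  assume "b < m" "c < n"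
  then have "b * n + c < Suc b * n" by simp
  also have "\<dots> \<le> m * n" using \<open>b < m\<close> by (intro mult_le_mono1) auto
  finally show ?thesis .
qed

lemma sum_lessThan_mult:
  fixes f :: "nat \<Rightarrow> 'a :: comm_monoid_add"
  shows "(\<Sum>s<m * n. f s) = (\<Sum>b<m. \<Sum>c<n. f (b * n + c))"
proof -
  have "sum f {b * n..<b * n + n} = (\<Sum>c<n. f (b * n + c))" for b
    using sum.shift_bounds_nat_ivl[of f 0 "b * n" n] by (simp add: lessThan_atLeast0 add.commute)
  then show ?thesis by (simp flip: sum.nat_group)
qed

lemma vec_l2norm_block_vec:
  assumes "\<And>j. j < m \<Longrightarrow> g j \<in> carrier_vec n"
  shows "(vec_l2norm (block_vec m n g))\<^sup>2 = (\<Sum>j<m. (vec_l2norm (g j))\<^sup>2)"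
proof -
  have "(vec_l2norm (block_vec m n g))\<^sup>2 = (\<Sum>s<m * n. (cmod (g (s div n) $ (s mod n)))\<^sup>2)"
    unfolding vec_l2norm_power2 by (simp add: block_vec_def)
  also have "\<dots> = (\<Sum>b<m. \<Sum>c<n. (cmod (g b $ c))\<^sup>2)"
    unfolding sum_lessThan_mult by (intro sum.cong) auto
  also have "\<dots> = (\<Sum>j<m. (vec_l2norm (g j))\<^sup>2)"
    using assms carrier_vecD by (intro sum.cong) (force simp: vec_l2norm_power2)+
  finally show ?thesis .
qed

lemma block_bidiag_carrier [simp]: "block_bidiag m n X \<in> carrier_mat (m * n) (m * n)"
  by (simp add: block_bidiag_def)

lemma block_bidiag_dim [simp]:
  "dim_row (block_bidiag m n X) = m * n" "dim_col (block_bidiag m n X) = m * n"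
  by (simp_all add: block_bidiag_def)

text \<open>In block row \<open>a\<close> only the block columns \<open>a\<close> and
  \<open>a - 1\<close> contribute, and in row 0 the latter is absent. This turns all work with the
  space-time matrices into recursions over blocks.\<close>

lemma block_bidiag_mult_block_vec:
  assumes X: "X \<in> carrier_mat n n" and g: "\<And>j. g j \<in> carrier_vec n"
  shows "block_bidiag m n X *\<^sub>v block_vec m n g =
    block_vec m n (\<lambda>j. if j = 0 then g 0 else g j - X *\<^sub>v g (j - 1))" (is "?L = ?R")
proof (intro eq_vecI)
  fix i assume "i < dim_vec ?R"
  then have i: "i < m * n" by simp
  define a r where "a = i div n" and "r = i mod n"
  have r: "r < n" and a: "a < m" using i by (auto simp: a_def r_def less_mult_imp_div_less) (metis gr_zeroI less_nat_zero_code mod_less_divisor mult_0_right)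
  have inner: "(\<Sum>c<n. block_bidiag m n X $$ (i, b * n + c) * block_vec m n g $ (b * n + c)) =
      (if b = a then g b $ r else 0) + (if a = b + 1 then - (X *\<^sub>v g b) $ r else 0)"
    if b: "b < m" for b
  proof -
    have "(\<Sum>c<n. block_bidiag m n X $$ (i, b * n + c) * block_vec m n g $ (b * n + c)) =
      (\<Sum>c<n. (if a = b then if r = c then 1 else 0 else if a = b + 1 then - (X $$ (r, c)) else 0)
        * g b $ c)"
      using b i X r block_index_less[OF b]
      by (intro sum.cong) (auto simp: block_bidiag_def block_vec_def a_def r_def)
    also have "\<dots> = (if b = a then g b $ r else 0) + (if a = b + 1 then - (X *\<^sub>v g b) $ r else 0)"
    proof (cases "a = b")
      case True
      have "(\<Sum>c<n. (if r = c then 1 else 0) * g b $ c) = (\<Sum>c<n. if r = c then g b $ c else 0)"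
        by (intro sum.cong) auto
      then show ?thesis using True r by simp
    next
      case False
      then show ?thesis
        using index_mult_mat_vec_sum[OF X g r, of b] X r g by (auto simp: sum_negf)
    qed
    finally show ?thesis .
  qed
  have "?L $ i = (\<Sum>s<m * n. block_bidiag m n X $$ (i, s) * block_vec m n g $ s)"
    using i by (intro index_mult_mat_vec_sum) auto
  also have "\<dots> = (\<Sum>b<m. (if b = a then g b $ r else 0) +
      (if a = b + 1 then - (X *\<^sub>v g b) $ r else 0))"
    unfolding sum_lessThan_mult by (intro sum.cong inner) auto
  also have "\<dots> = g a $ r + (\<Sum>b<m. if a = b + 1 then - (X *\<^sub>v g b) $ r else 0)"
    using a by (simp add: sum.distrib)
  also have "\<dots> = ?R $ i"
  proof (cases a)
    case 0
    then show ?thesis using i r by (simp add: block_vec_def flip: a_def r_def)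
  next
    case (Suc p)
    have "(\<Sum>b<m. if a = b + 1 then - (X *\<^sub>v g b) $ r else 0) =
        (\<Sum>b<m. if b = p then - (X *\<^sub>v g p) $ r else 0)"
      using Suc by (intro sum.cong) auto
    also have "\<dots> = - ((X *\<^sub>v g p) $ r)" using a Suc X g r by (simp add: carrier_vecD[OF mult_mat_vec_carrier[OF X g]])
    finally show ?thesis using i r Suc X g carrier_vecD[OF g]
      by (simp add: block_vec_def flip: a_def r_def)
  qed
  finally show "?L $ i = ?R $ i" .
qed simp

section \<open>Unit triangularity and determinants\<close>

lemma block_bidiag_upper_zero:
  assumes "r < s" "s < m * n"
  shows "block_bidiag m n X $$ (r, s) = 0"
proof -
  have n: "n > 0" using assms by (cases n) auto
  have "r div n \<le> s div n" using assms by (simp add: div_le_mono)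
  moreover have "r mod n \<noteq> s mod n" if "r div n = s div n"
    using that assms by (metis div_mult_mod_eq less_irrefl)
  ultimately show ?thesis using assms n by (auto simp: block_bidiag_def)
qed

lemma block_bidiag_diag: "r < m * n \<Longrightarrow> block_bidiag m n X $$ (r, r) = 1"
  by (cases n) (auto simp: block_bidiag_def)

lemma det_unit_lower_triangular:
  fixes A :: "'a :: comm_ring_1 mat"
  assumes A: "A \<in> carrier_mat n n" and upper: "\<And>i j. i < j \<Longrightarrow> j < n \<Longrightarrow> A $$ (i, j) = 0"
    and diag: "\<And>i. i < n \<Longrightarrow> A $$ (i, i) = 1"
  shows "det A = 1"
proof -
  have "det A = prod_list (diag_mat A)" by (rule det_lower_triangular[OF upper A])
  also have "\<dots> = 1" using A diag by (auto simp: prod_list_diag_prod)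
  finally show ?thesis .
qed

text \<open>Because the diagonal blocks are identities, block triangularity is here triangularity
  entry by entry.\<close>

lemma det_block_bidiag: "det (block_bidiag m n X) = 1"
  by (rule det_unit_lower_triangular[of _ "m * n"])
    (auto simp: block_bidiag_upper_zero block_bidiag_diag)

section \<open>Subvectors and submatrices\<close>

text \<open>\<open>S\<close> may be infinite, in which case its own \<open>card\<close> is 0;
  monotonicity is therefore read off the truncation of \<open>S\<close> below
  \<open>M\<close>.\<close>

lemma pick_less_pick:
  assumes "i < j" "j < card {a. a < M \<and> a \<in> S}"
  shows "pick S i < pick S j"
  using assms pick_mono_le[of j "{a. a < M \<and> a \<in> S}" i]
    pick_reduce_set[of i M S] pick_reduce_set[of j M S] by simp

lemma bij_betw_pick:
  "bij_betw (pick S) {..<card {a. a < M \<and> a \<in> S}} {a. a < M \<and> a \<in> S}"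
proof -
  let ?S = "{a. a < M \<and> a \<in> S}"
  have inj: "inj_on (pick S) {..<card ?S}"
  proof (rule inj_onI)
    fix i j assume "i \<in> {..<card ?S}" "j \<in> {..<card ?S}" "pick S i = pick S j"
    then show "i = j"
      using pick_less_pick[of i j M S] pick_less_pick[of j i M S]
      by (cases i j rule: linorder_cases) auto
  qed
  have "pick S i \<in> ?S" if "i < card ?S" for i
    using pick_in_set_le[OF that] pick_reduce_set[OF that] by simp
  then have sub: "pick S ` {..<card ?S} \<subseteq> ?S" by blast
  have "pick S ` {..<card ?S} = ?S"
    using sub by (intro card_subset_eq) (auto simp: card_image[OF inj])
  then show ?thesis using inj by (simp add: bij_betw_def)
qed

text \<open>Exactly \<open>i\<close> values of \<open>h\<close> lie below \<open>h i\<close>, and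
  this count determines \<open>pick\<close>.\<close>

lemma pick_enumerate:
  assumes h: "strict_mono h" and S: "range h = S"
  shows "pick S i = h i"
proof -
  have "{a \<in> S. a < h i} = h ` {..<i}"
    using S strict_mono_less[OF h] by auto
  then have "card {a \<in> S. a < h i} = i"
    using card_image[OF strict_mono_imp_inj_on[OF h], of "{..<i}"] by simp
  then show ?thesis
    using pick_card_in_set[of "h i" S] S by auto
qed

text \<open>Vector counterpart of \<open>submatrix\<close>, with the same \<open>pick\<close>
  ordering, so that the two fit together in products.\<close>

definition subvec :: "complex vec \<Rightarrow> nat set \<Rightarrow> complex vec" where
  "subvec u S = vec (card {i. i < dim_vec u \<and> i \<in> S}) (\<lambda>i. u $ pick S i)"

lemma subvec_dim [simp]: "dim_vec (subvec u S) = card {i. i < dim_vec u \<and> i \<in> S}"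
  by (simp add: subvec_def)

lemma sum_subvec:
  "(\<Sum>i<dim_vec (subvec u S). f (subvec u S $ i)) = (\<Sum>s | s < dim_vec u \<and> s \<in> S. f (u $ s))"
proof -
  have "(\<Sum>i<dim_vec (subvec u S). f (subvec u S $ i)) =
      (\<Sum>i<card {i. i < dim_vec u \<and> i \<in> S}. f (u $ pick S i))"
    by (simp add: subvec_def)
  also have "\<dots> = (\<Sum>s | s < dim_vec u \<and> s \<in> S. f (u $ s))"
    by (rule sum.reindex_bij_betw[OF bij_betw_pick, of "\<lambda>s. f (u $ s)"])
  finally show ?thesis .
qed

text \<open>Reordering with F-points first is a permutation of the entries, so the norm of a
  residual may be computed in time order.\<close>

lemma vec_l2norm_subvec_split:
  "(vec_l2norm (subvec u S @\<^sub>v subvec u (- S)))\<^sup>2 = (vec_l2norm u)\<^sup>2"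
proof -
  have "(vec_l2norm (subvec u S @\<^sub>v subvec u (- S)))\<^sup>2 =
      (\<Sum>s | s < dim_vec u \<and> s \<in> S. (cmod (u $ s))\<^sup>2) +
      (\<Sum>s | s < dim_vec u \<and> s \<in> - S. (cmod (u $ s))\<^sup>2)"
    unfolding vec_l2norm_append_power2
    unfolding vec_l2norm_power2 sum_subvec[where f = "\<lambda>z. (cmod z)\<^sup>2"] ..
  also have "\<dots> = (\<Sum>s\<in>{s. s < dim_vec u \<and> s \<in> S} \<union> {s. s < dim_vec u \<and> s \<in> - S}. (cmod (u $ s))\<^sup>2)"
    by (intro sum.union_disjoint[symmetric]) auto
  also have "{s. s < dim_vec u \<and> s \<in> S} \<union> {s. s < dim_vec u \<and> s \<in> - S} = {..<dim_vec u}"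
    by auto
  finally show ?thesis by (simp add: vec_l2norm_power2)
qed

text \<open>Columns outside \<open>J\<close> meet only zeros of \<open>u\<close>. Thus
  \<open>A_ff\<close> and \<open>A_cf\<close> can be applied through the full bidiagonal matrix in
  time order.\<close>

lemma submatrix_mult_subvec:
  assumes A: "A \<in> carrier_mat m l" and u: "u \<in> carrier_vec l"
    and zero: "\<And>s. s < l \<Longrightarrow> s \<notin> J \<Longrightarrow> u $ s = 0"
  shows "submatrix A I J *\<^sub>v subvec u J = subvec (A *\<^sub>v u) I"
proof (intro eq_vecI)
  fix i assume "i < dim_vec (subvec (A *\<^sub>v u) I)"
  then have i: "i < card {i. i < m \<and> i \<in> I}" using A by simp
  have pi: "pick I i < m" using pick_le[OF i] .
  let ?J = "{s. s < l \<and> s \<in> J}"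
  have dims: "dim_row A = m" "dim_col A = l" "dim_vec u = l" using A u by auto
  have "(submatrix A I J *\<^sub>v subvec u J) $ i =
      (\<Sum>j<card ?J. submatrix A I J $$ (i, j) * subvec u J $ j)"
    using i by (intro index_mult_mat_vec_sum[of _ "card {i. i < m \<and> i \<in> I}"])
      (auto intro!: carrier_matI carrier_vecI simp: dim_submatrix dims)
  also have "\<dots> = (\<Sum>j<card ?J. A $$ (pick I i, pick J j) * u $ pick J j)"
    using i by (intro sum.cong) (auto simp: submatrix_index subvec_def dims)
  also have "\<dots> = (\<Sum>s\<in>?J. A $$ (pick I i, s) * u $ s)"
    by (rule sum.reindex_bij_betw[OF bij_betw_pick, of "\<lambda>s. A $$ (pick I i, s) * u $ s"])
  also have "\<dots> = (\<Sum>s<l. A $$ (pick I i, s) * u $ s)"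
    using zero by (intro sum.mono_neutral_left) auto
  also have "\<dots> = (A *\<^sub>v u) $ pick I i"
    using index_mult_mat_vec_sum[OF A u pi] by simp
  also have "\<dots> = subvec (A *\<^sub>v u) I $ i"
    using i A by (simp add: subvec_def)
  finally show "(submatrix A I J *\<^sub>v subvec u J) $ i = subvec (A *\<^sub>v u) I $ i" .
qed (simp add: dim_submatrix)

text \<open>Since \<open>pick\<close> is increasing, a principal submatrix of a unit lower
  triangular matrix is again one. Invertibility of \<open>A_ff\<close> follows without describing
  its blocks.\<close>

lemma det_submatrix_block_bidiag: "det (submatrix (block_bidiag m n X) I I) = 1"
proof (rule det_unit_lower_triangular)
  let ?c = "card {i. i < m * n \<and> i \<in> I}"
  show "submatrix (block_bidiag m n X) I I \<in> carrier_mat ?c ?c"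
    by (intro carrier_matI) (simp_all add: dim_submatrix)
  fix j assume j: "j < ?c"
  then show "submatrix (block_bidiag m n X) I I $$ (j, j) = 1"
    using pick_le[OF j] by (simp add: submatrix_index block_bidiag_diag)
  fix i assume "i < j"
  then show "submatrix (block_bidiag m n X) I I $$ (i, j) = 0"
    using j pick_le[OF j] pick_less_pick[OF \<open>i < j\<close> j]
    by (simp add: submatrix_index block_bidiag_upper_zero)
qed

lemma append_cols_mult_append_vec:
  assumes "A \<in> carrier_mat m a" "B \<in> carrier_mat m b" "u \<in> carrier_vec a" "v \<in> carrier_vec b"
  shows "append_cols A B *\<^sub>v (u @\<^sub>v v) = A *\<^sub>v u + B *\<^sub>v v"
proof (intro eq_vecI)
  fix i assume "i < dim_vec (A *\<^sub>v u + B *\<^sub>v v)"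
  then have i: "i < m" using assms by simp
  have "row (append_cols A B) i = row A i @\<^sub>v row B i"
    using assms i unfolding append_cols_def by (intro eq_vecI) auto
  then show "(append_cols A B *\<^sub>v (u @\<^sub>v v)) $ i = (A *\<^sub>v u + B *\<^sub>v v) $ i"
    using assms i
    by (simp add: append_cols_def scalar_prod_append[of _ a _ b] row_carrier_vec[of _ m])
qed (use assms in \<open>simp add: append_cols_def\<close>)

lemma zero_append_rows_mult_vec:
  fixes E :: "complex mat"
  assumes "E \<in> carrier_mat m l" "v \<in> carrier_vec l"
  shows "(0\<^sub>m a l @\<^sub>r E) *\<^sub>v v = 0\<^sub>v a @\<^sub>v (E *\<^sub>v v)"
proof -
  have "(0\<^sub>m a l :: complex mat) *\<^sub>v v = 0\<^sub>v a" using assms by (intro eq_vecI) auto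
  then show ?thesis
    using mat_mult_append[of "0\<^sub>m a l" a l E m v] assms by simp
qed

section \<open>C-points and the residual restriction\<close>

lemma F_dofs_eq: "F_dofs n k = - C_dofs n k"
  by (auto simp: F_dofs_def C_dofs_def)

text \<open>The map sends component c of coarse block q to component c of fine block
  \<open>q * k\<close>; it is the explicit enumeration of \<open>C_dofs\<close>.\<close>

lemma strict_mono_C_index:
  assumes n: "n > 0" and k: "k \<ge> 1"
  shows "strict_mono (\<lambda>i :: nat. i div n * k * n + i mod n)"
proof (rule strict_monoI)
  fix x y :: nat assume "x < y"
  then have le: "x div n \<le> y div n" by (simp add: div_le_mono)
  show "x div n * k * n + x mod n < y div n * k * n + y mod n"
  proof (cases "x div n = y div n")
    case True
    then have "x mod n < y mod n"
      using \<open>x < y\<close> by (metis div_mult_mod_eq nat_add_left_cancel_less)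
    then show ?thesis using True by simp
  next
    case False
    then have lt: "Suc (x div n) \<le> y div n" using le by simp
    have "x div n * k * n + x mod n < x div n * k * n + 1 * n" using n by simp
    also have "\<dots> \<le> x div n * k * n + k * n" using k by (intro add_left_mono mult_le_mono1)
    also have "\<dots> = Suc (x div n) * k * n" by (simp add: algebra_simps)
    also have "\<dots> \<le> y div n * k * n" using lt by (intro mult_le_mono1)
    finally show ?thesis by simp
  qed
qed

lemma range_C_index:
  assumes n: "n > 0"
  shows "range (\<lambda>i. i div n * k * n + i mod n) = C_dofs n k"
proof (intro equalityI subsetI)
  fix r assume "r \<in> range (\<lambda>i. i div n * k * n + i mod n)"
  then show "r \<in> C_dofs n k" using n by (auto simp: C_dofs_def)
next
  fix r assume "r \<in> C_dofs n k"
  then obtain q where q: "r div n = q * k"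
    unfolding C_dofs_def dvd_def mem_Collect_eq by (metis mult.commute)
  have "r = (\<lambda>i. i div n * k * n + i mod n) (q * n + r mod n)"
    using n div_mult_mod_eq[of r n] by (simp add: q)
  then show "r \<in> range (\<lambda>i. i div n * k * n + i mod n)" by blast
qed

lemma pick_C_dofs: "n > 0 \<Longrightarrow> k \<ge> 1 \<Longrightarrow> pick (C_dofs n k) i = i div n * k * n + i mod n"
  by (rule pick_enumerate[OF strict_mono_C_index range_C_index])

text \<open>The last time point \<open>(Nc - 1) * k\<close> is itself a C-point, so exactly
  \<open>Nc\<close> multiples of \<open>k\<close> fit below \<open>num_points Nc k\<close>.\<close>

lemma card_C_dofs:
  assumes k: "k \<ge> 1" and Nc: "Nc \<ge> 1"
  shows "card {r. r < num_points Nc k * n \<and> r \<in> C_dofs n k} = Nc * n"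
proof (cases "n = 0")
  case False
  then have n: "n > 0" by simp
  let ?h = "\<lambda>i. i div n * k * n + i mod n"
  have less: "?h i < num_points Nc k * n \<longleftrightarrow> i < Nc * n" for i
  proof
    assume "i < Nc * n"
    then have "i div n < Nc" by (simp add: less_mult_imp_div_less)
    then have "i div n \<le> Nc - 1" by simp
    then have "i div n * k \<le> (Nc - 1) * k" by (rule mult_le_mono1)
    then have "i div n * k < num_points Nc k" unfolding num_points_def by linarith
    then show "?h i < num_points Nc k * n" using n by (intro block_index_less) auto
  next
    assume "?h i < num_points Nc k * n"
    then have "?h i div n < num_points Nc k" by (simp add: less_mult_imp_div_less)
    moreover have "?h i div n = i div n * k" using n by simp
    ultimately have "i div n * k \<le> (Nc - 1) * k" unfolding num_points_def by linarith
    then have "i div n < Nc" using k Nc by auto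
    then show "i < Nc * n" using n block_index_less[of "i div n" Nc "i mod n" n] by simp
  qed
  have "{r. r < num_points Nc k * n \<and> r \<in> C_dofs n k} = ?h ` {..<Nc * n}"
    unfolding range_C_index[OF n, symmetric] using less by auto
  then show ?thesis
    using card_image[OF strict_mono_imp_inj_on[OF strict_mono_C_index[OF n k]], of "{..<Nc * n}"]
    by simp
qed simp

lemma subvec_C_block_vec:
  assumes k: "k \<ge> 1" and Nc: "Nc \<ge> 1"
  shows "subvec (block_vec (num_points Nc k) n g) (C_dofs n k) = block_vec Nc n (\<lambda>j. g (j * k))"
proof (intro eq_vecI)
  fix i assume "i < dim_vec (block_vec Nc n (\<lambda>j. g (j * k)))"
  then have i: "i < Nc * n" by simp
  then have n: "n > 0" by (cases n) auto
  have c: "i < card {r. r < num_points Nc k * n \<and> r \<in> C_dofs n k}"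
    using i card_C_dofs[OF k Nc] by simp
  from pick_le[OF c] have "i div n * k * n + i mod n < num_points Nc k * n"
    unfolding pick_C_dofs[OF n k] .
  then show "subvec (block_vec (num_points Nc k) n g) (C_dofs n k) $ i =
      block_vec Nc n (\<lambda>j. g (j * k)) $ i"
    using n i c by (simp add: subvec_def pick_C_dofs[OF n k] block_vec_def)
qed (simp add: card_C_dofs[OF k Nc])

lemma block_vec_add:
  assumes "\<And>j. g j \<in> carrier_vec n" "\<And>j. h j \<in> carrier_vec n"
  shows "block_vec m n (\<lambda>j. g j + h j) = block_vec m n g + block_vec m n h"
proof (intro eq_vecI)
  fix i assume "i < dim_vec (block_vec m n g + block_vec m n h)"
  then have i: "i < m * n" by simp
  then have "i mod n < n" by (cases n) auto
  then show "block_vec m n (\<lambda>j. g j + h j) $ i = (block_vec m n g + block_vec m n h) $ i"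
    using i carrier_vecD[OF assms(2)] by (simp add: block_vec_def)
qed simp

lemma A_ff_carrier:
  "A_ff n Nc k \<Phi> \<in> carrier_mat (card {r. r < num_points Nc k * n \<and> r \<in> F_dofs n k})
    (card {r. r < num_points Nc k * n \<and> r \<in> F_dofs n k})"
  by (intro carrier_matI) (simp_all add: A_ff_def dim_submatrix)

lemma A_cf_carrier:
  assumes "k \<ge> 1" "Nc \<ge> 1"
  shows "A_cf n Nc k \<Phi> \<in> carrier_mat (Nc * n)
    (card {r. r < num_points Nc k * n \<and> r \<in> F_dofs n k})"
  using card_C_dofs[OF assms] by (intro carrier_matI) (simp_all add: A_cf_def dim_submatrix)

lemma residual_restriction_dim_col:
  "dim_col (residual_restriction n Nc k \<Phi>) =
    card {r. r < num_points Nc k * n \<and> r \<in> F_dofs n k} + Nc * n"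
  using A_ff_carrier[of n Nc k \<Phi>] mat_inv_det_nonzero(1)[OF A_ff_carrier, of n Nc k \<Phi>]
  by (simp add: residual_restriction_def append_cols_def A_ff_def det_submatrix_block_bidiag)

text \<open>Instead of inverting \<open>A_ff\<close>, the F-part \<open>\<mu>\<close> of the solution is prescribed and the
  residual is read off from it.\<close>

lemma residual_restriction_mult:
  assumes k: "k \<ge> 1" and Nc: "Nc \<ge> 1" and \<Phi>: "\<Phi> \<in> carrier_mat n n"
    and \<mu>: "\<And>p. \<mu> p \<in> carrier_vec n" and \<mu>0: "\<And>j. \<mu> (j * k) = 0\<^sub>v n"
    and f: "\<And>j. f j \<in> carrier_vec n"
  defines "r \<equiv> block_vec (num_points Nc k) n (\<lambda>p.
    (if p = 0 then \<mu> 0 else \<mu> p - \<Phi> *\<^sub>v \<mu> (p - 1)) + (if k dvd p then f (p div k) else 0\<^sub>v n))"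
  shows "residual_restriction n Nc k \<Phi> *\<^sub>v (subvec r (F_dofs n k) @\<^sub>v subvec r (C_dofs n k)) =
    block_vec Nc n f"
proof -
  let ?N = "num_points Nc k"
  let ?F = "F_dofs n k" and ?C = "C_dofs n k"
  let ?nF = "card {r. r < ?N * n \<and> r \<in> ?F}"
  \<comment> \<open>\<open>U\<close> vanishes at the C-points, so A U has F-part
    \<open>A_ff u\<close> and C-part \<open>A_cf u\<close>. The residual \<open>r\<close> is A U
    plus \<open>f\<close> at the C-points; in its restriction the two copies of
    \<open>A_cf u\<close> cancel and \<open>f\<close> remains.\<close>
  define g where "g p = (if p = 0 then \<mu> 0 else \<mu> p - \<Phi> *\<^sub>v \<mu> (p - 1))" for p
  define U where "U = block_vec ?N n \<mu>"
  define u where "u = subvec U ?F"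
  have g: "g p \<in> carrier_vec n" for p
    using \<mu> \<Phi> by (auto simp: g_def intro!: minus_carrier_vec mult_mat_vec_carrier)
  have U: "U \<in> carrier_vec (?N * n)" by (simp add: U_def)
  have u: "u \<in> carrier_vec ?nF" by (simp add: u_def U_def carrier_vecI)
  have AU: "block_bidiag ?N n \<Phi> *\<^sub>v U = block_vec ?N n g"
    unfolding U_def g_def by (rule block_bidiag_mult_block_vec[OF \<Phi> \<mu>])
  have zero: "U $ s = 0" if "s < ?N * n" "s \<notin> ?F" for s
  proof -
    have "n > 0" using that by (cases n) auto
    have "k dvd s div n" using that by (simp add: F_dofs_def)
    then obtain q where "s div n = q * k" by (metis dvd_def mult.commute)
    then show ?thesis using that \<mu>0 \<open>n > 0\<close> by (simp add: U_def block_vec_def)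
  qed
  have ffu: "A_ff n Nc k \<Phi> *\<^sub>v u = subvec (block_vec ?N n g) ?F"
    unfolding A_ff_def u_def AU[symmetric] by (rule submatrix_mult_subvec[OF _ U zero]) auto
  have cfu: "A_cf n Nc k \<Phi> *\<^sub>v u = block_vec Nc n (\<lambda>j. g (j * k))"
    unfolding A_cf_def u_def subvec_C_block_vec[OF k Nc, symmetric] AU[symmetric]
    by (rule submatrix_mult_subvec[OF _ U zero]) auto
  have rF: "subvec r ?F = A_ff n Nc k \<Phi> *\<^sub>v u"
  proof (unfold ffu, intro eq_vecI)
    fix i assume "i < dim_vec (subvec (block_vec ?N n g) ?F)"
    then have i: "i < ?nF" by simp
    define s where "s = pick ?F i"
    have s: "s < ?N * n" "s \<in> ?F"
      using bij_betwE[OF bij_betw_pick[of ?F "?N * n"]] i by (auto simp: s_def)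
    have "s mod n < n" using s by (cases n) auto
    then have "r $ s = block_vec ?N n g $ s"
      using s carrier_vecD[OF g] by (simp add: r_def block_vec_def F_dofs_def flip: g_def)
    then show "subvec r ?F $ i = subvec (block_vec ?N n g) ?F $ i"
      using i by (simp add: subvec_def r_def flip: s_def)
  qed (simp add: r_def)
  have "subvec r ?C = block_vec Nc n (\<lambda>j. g (j * k) + f j)"
    unfolding r_def subvec_C_block_vec[OF k Nc] g_def using k by (intro block_vec_cong) auto
  also have "\<dots> = block_vec Nc n (\<lambda>j. g (j * k)) + block_vec Nc n f"
    by (rule block_vec_add[OF g f])
  finally have rC: "subvec r ?C = block_vec Nc n (\<lambda>j. g (j * k)) + block_vec Nc n f" .
  have det: "det (A_ff n Nc k \<Phi>) \<noteq> 0" by (simp add: A_ff_def det_submatrix_block_bidiag)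
  note ff = A_ff_carrier[of n Nc k \<Phi>] and cf = A_cf_carrier[OF k Nc, of n \<Phi>]
  note inv = mat_inv_det_nonzero(1)[OF ff det]
  have "(A_cf n Nc k \<Phi> * mat_inv (A_ff n Nc k \<Phi>)) *\<^sub>v (A_ff n Nc k \<Phi> *\<^sub>v u) =
      A_cf n Nc k \<Phi> *\<^sub>v (mat_inv (A_ff n Nc k \<Phi>) *\<^sub>v (A_ff n Nc k \<Phi> *\<^sub>v u))"
    by (rule assoc_mult_mat_vec[OF cf inv mult_mat_vec_carrier[OF ff u]])
  also have "\<dots> = block_vec Nc n (\<lambda>j. g (j * k))"
    unfolding mat_inv_mult_mat_vec_cancel(1)[OF ff det u] by (rule cfu)
  finally have cff: "(A_cf n Nc k \<Phi> * mat_inv (A_ff n Nc k \<Phi>)) *\<^sub>v subvec r ?F =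
      block_vec Nc n (\<lambda>j. g (j * k))" unfolding rF .
  have rFc: "subvec r ?F \<in> carrier_vec ?nF" and rCc: "subvec r ?C \<in> carrier_vec (Nc * n)"
    unfolding rF rC using mult_mat_vec_carrier[OF ff u] by (auto intro!: add_carrier_vec)
  have "residual_restriction n Nc k \<Phi> *\<^sub>v (subvec r ?F @\<^sub>v subvec r ?C) =
      - (A_cf n Nc k \<Phi> * mat_inv (A_ff n Nc k \<Phi>)) *\<^sub>v subvec r ?F + 1\<^sub>m (Nc * n) *\<^sub>v subvec r ?C"
    unfolding residual_restriction_def
    by (rule append_cols_mult_append_vec[OF _ _ rFc rCc]) (use cf inv in auto)
  also have "\<dots> = - block_vec Nc n (\<lambda>j. g (j * k)) + subvec r ?C"
  proof -
    have "- (A_cf n Nc k \<Phi> * mat_inv (A_ff n Nc k \<Phi>)) *\<^sub>v subvec r ?F =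
        - block_vec Nc n (\<lambda>j. g (j * k))"
      unfolding cff[symmetric] using carrier_vecD[OF rFc] carrier_matD[OF inv]
      by (intro uminus_mult_mat_vec) simp
    then show ?thesis using rCc by simp
  qed
  also have "\<dots> = block_vec Nc n f" unfolding rC by (intro eq_vecI) auto
  finally show ?thesis .
qed

section \<open>Power Gramians\<close>

text \<open>Entrywise for the same reason as \<open>power_gram\<close>: vectors of unconstrained
  length form no additive monoid.\<close>

definition vec_sum :: "nat \<Rightarrow> ('b \<Rightarrow> complex vec) \<Rightarrow> 'b set \<Rightarrow> complex vec" where
  "vec_sum n x L = vec n (\<lambda>i. \<Sum>l\<in>L. x l $ i)"

lemma vec_sum_carrier [simp]: "vec_sum n x L \<in> carrier_vec n"
  by (simp add: vec_sum_def)

lemma mult_mat_vec_vec_sum: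
  assumes A: "A \<in> carrier_mat m n" and x: "\<And>l. l \<in> L \<Longrightarrow> x l \<in> carrier_vec n"
  shows "A *\<^sub>v vec_sum n x L = vec_sum m (\<lambda>l. A *\<^sub>v x l) L"
proof (intro eq_vecI)
  fix i assume "i < dim_vec (vec_sum m (\<lambda>l. A *\<^sub>v x l) L)"
  then have i: "i < m" by (simp add: vec_sum_def)
  have "(A *\<^sub>v vec_sum n x L) $ i = (\<Sum>j<n. \<Sum>l\<in>L. A $$ (i, j) * x l $ j)"
    using index_mult_mat_vec_sum[OF A _ i, of "vec_sum n x L"]
    by (simp add: vec_sum_def sum_distrib_left)
  also have "\<dots> = (\<Sum>l\<in>L. \<Sum>j<n. A $$ (i, j) * x l $ j)" by (rule sum.swap)
  also have "\<dots> = (\<Sum>l\<in>L. (A *\<^sub>v x l) $ i)"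
    using index_mult_mat_vec_sum[OF A x i] by (intro sum.cong) auto
  finally show "(A *\<^sub>v vec_sum n x L) $ i = vec_sum m (\<lambda>l. A *\<^sub>v x l) L $ i"
    using i by (simp add: vec_sum_def)
qed (use A in \<open>simp add: vec_sum_def\<close>)

context
  fixes n :: nat and \<Phi> :: "complex mat"
  assumes \<Phi>: "\<Phi> \<in> carrier_mat n n"
begin

lemma pow_adjoint_carrier: "\<Phi> ^\<^sub>m l \<in> carrier_mat n n" "mat_adjoint (\<Phi> ^\<^sub>m l) \<in> carrier_mat n n"
  using \<Phi> by (auto simp: pow_carrier_mat)

lemma pow_mat_add_mult_vec:
  "v \<in> carrier_vec n \<Longrightarrow> (\<Phi> ^\<^sub>m (a + b)) *\<^sub>v v = \<Phi> ^\<^sub>m a *\<^sub>v (\<Phi> ^\<^sub>m b *\<^sub>v v)"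
proof (induction b arbitrary: v)
  case (Suc b)
  then show ?case
    using \<Phi> pow_adjoint_carrier(1) by (simp add: assoc_mult_mat_vec[of _ n n _ n])
qed (use \<Phi> in simp)

lemma pow_mat_add: "\<Phi> ^\<^sub>m (a + b) = \<Phi> ^\<^sub>m a * \<Phi> ^\<^sub>m b"
  using \<Phi> pow_adjoint_carrier(1)
  by (induction b) (auto simp: assoc_mult_mat[of _ n n _ n _ n])

lemma power_gram_carrier: "power_gram \<Phi> L \<in> carrier_mat n n"
  using \<Phi> by (simp add: power_gram_def)

lemma power_gram_mult_vec:
  assumes v: "v \<in> carrier_vec n"
  shows "power_gram \<Phi> L *\<^sub>v v = vec_sum n (\<lambda>l. \<Phi> ^\<^sub>m l *\<^sub>v (mat_adjoint (\<Phi> ^\<^sub>m l) *\<^sub>v v)) L"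
proof (intro eq_vecI)
  let ?Y = "\<lambda>l. \<Phi> ^\<^sub>m l * mat_adjoint (\<Phi> ^\<^sub>m l)"
  have Y: "?Y l \<in> carrier_mat n n" for l by (rule mult_carrier_mat[OF pow_adjoint_carrier])
  fix i assume "i < dim_vec (vec_sum n (\<lambda>l. \<Phi> ^\<^sub>m l *\<^sub>v (mat_adjoint (\<Phi> ^\<^sub>m l) *\<^sub>v v)) L)"
  then have i: "i < n" by (simp add: vec_sum_def)
  have "(power_gram \<Phi> L *\<^sub>v v) $ i = (\<Sum>j<n. \<Sum>l\<in>L. ?Y l $$ (i, j) * v $ j)"
    using index_mult_mat_vec_sum[OF power_gram_carrier v i] i \<Phi>
    by (simp add: power_gram_def sum_distrib_right)
  also have "\<dots> = (\<Sum>l\<in>L. \<Sum>j<n. ?Y l $$ (i, j) * v $ j)" by (rule sum.swap)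
  also have "\<dots> = (\<Sum>l\<in>L. (?Y l *\<^sub>v v) $ i)"
    unfolding index_mult_mat_vec_sum[OF Y v i] ..
  also have "\<dots> = (\<Sum>l\<in>L. (\<Phi> ^\<^sub>m l *\<^sub>v (mat_adjoint (\<Phi> ^\<^sub>m l) *\<^sub>v v)) $ i)"
    using assoc_mult_mat_vec[OF pow_adjoint_carrier v] by simp
  finally show "(power_gram \<Phi> L *\<^sub>v v) $ i =
      vec_sum n (\<lambda>l. \<Phi> ^\<^sub>m l *\<^sub>v (mat_adjoint (\<Phi> ^\<^sub>m l) *\<^sub>v v)) L $ i"
    using i by (simp add: vec_sum_def)
qed (use \<Phi> in \<open>simp add: power_gram_def vec_sum_def\<close>)

text \<open>Moving \<Phi>^l to the other side of the scalar product makes every summand a squared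
  norm. This gives semidefiniteness and, later, the cost of a residual.\<close>

lemma power_gram_quadratic_form:
  assumes v: "v \<in> carrier_vec n"
  shows "(power_gram \<Phi> L *\<^sub>v v) \<bullet>c v =
    complex_of_real (\<Sum>l\<in>L. (vec_l2norm (mat_adjoint (\<Phi> ^\<^sub>m l) *\<^sub>v v))\<^sup>2)"
proof -
  let ?y = "\<lambda>l. \<Phi> ^\<^sub>m l *\<^sub>v (mat_adjoint (\<Phi> ^\<^sub>m l) *\<^sub>v v)"
  have y: "mat_adjoint (\<Phi> ^\<^sub>m l) *\<^sub>v v \<in> carrier_vec n" for l
    using pow_adjoint_carrier(2) v by (rule mult_mat_vec_carrier)
  have "(power_gram \<Phi> L *\<^sub>v v) \<bullet>c v = (\<Sum>i<n. \<Sum>l\<in>L. ?y l $ i * cnj (v $ i))"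
    unfolding power_gram_mult_vec[OF v] vec_sum_def
    using v by (auto simp: scalar_prod_def lessThan_atLeast0 sum_distrib_right intro!: sum.cong)
  also have "\<dots> = (\<Sum>l\<in>L. \<Sum>i<n. ?y l $ i * cnj (v $ i))" by (rule sum.swap)
  also have "\<dots> = (\<Sum>l\<in>L. ?y l \<bullet>c v)"
    using v by (intro sum.cong) (auto simp: scalar_prod_def lessThan_atLeast0)
  also have "\<dots> = (\<Sum>l\<in>L. complex_of_real ((vec_l2norm (mat_adjoint (\<Phi> ^\<^sub>m l) *\<^sub>v v))\<^sup>2))"
    unfolding cscalar_mult_mat_vec[OF pow_adjoint_carrier(1) y v] cscalar_self ..
  finally show ?thesis by simp
qed

lemma psd_power_gram: "psd_mat n (power_gram \<Phi> L)"
proof -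
  let ?Y = "\<lambda>l. \<Phi> ^\<^sub>m l * mat_adjoint (\<Phi> ^\<^sub>m l)"
  have herm: "(\<Phi> ^\<^sub>m l * mat_adjoint (\<Phi> ^\<^sub>m l)) $$ (i, j) =
      cnj ((\<Phi> ^\<^sub>m l * mat_adjoint (\<Phi> ^\<^sub>m l)) $$ (j, i))" if "i < n" "j < n" for i j l
    using that \<Phi> by (simp add: scalar_prod_def mult.commute)
  have "mat_adjoint (power_gram \<Phi> L) = power_gram \<Phi> L"
  proof (intro eq_matI)
    fix i j assume "i < dim_row (power_gram \<Phi> L)" "j < dim_col (power_gram \<Phi> L)"
    then have ij: "i < n" "j < n" using power_gram_carrier[of L] by auto
    have "mat_adjoint (power_gram \<Phi> L) $$ (i, j) = cnj (\<Sum>l\<in>L. ?Y l $$ (j, i))"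
      using ij \<Phi> by (simp add: power_gram_def del: index_mult_mat(1))
    also have "\<dots> = (\<Sum>l\<in>L. cnj (?Y l $$ (j, i)))" by (rule cnj_sum)
    also have "\<dots> = (\<Sum>l\<in>L. ?Y l $$ (i, j))" by (intro sum.cong refl herm[symmetric] ij)
    also have "\<dots> = power_gram \<Phi> L $$ (i, j)"
      using ij \<Phi> by (simp add: power_gram_def del: index_mult_mat(1))
    finally show "mat_adjoint (power_gram \<Phi> L) $$ (i, j) = power_gram \<Phi> L $$ (i, j)" .
  qed (use power_gram_carrier[of L] in auto)
  then show ?thesis
    using power_gram_carrier power_gram_quadratic_form
    by (auto simp: psd_mat_def less_eq_complex_def sum_nonneg)
qed

text \<open>Since \<Phi>^(k+l) = \<Phi>^k \<Phi>^l, the outer factors \<Phi>^k and adj(\<Phi>^k)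
  come out of the sum. This reduces FCF-relaxation to the residuals built for F-relaxation.\<close>

lemma power_gram_shift_mult_vec:
  assumes v: "v \<in> carrier_vec n"
  shows "power_gram \<Phi> {k..<2 * k} *\<^sub>v v =
    \<Phi> ^\<^sub>m k *\<^sub>v (power_gram \<Phi> {0..<k} *\<^sub>v (mat_adjoint (\<Phi> ^\<^sub>m k) *\<^sub>v v))"
proof -
  define y where "y = mat_adjoint (\<Phi> ^\<^sub>m k) *\<^sub>v v"
  note pc = pow_adjoint_carrier
  have y: "y \<in> carrier_vec n" unfolding y_def using pc(2) v by (rule mult_mat_vec_carrier)
  have adj: "mat_adjoint (\<Phi> ^\<^sub>m (k + l)) *\<^sub>v v = mat_adjoint (\<Phi> ^\<^sub>m l) *\<^sub>v y" for l
    unfolding pow_mat_add mat_adjoint_mult[OF pc(1) pc(1)] y_def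
    by (rule assoc_mult_mat_vec[OF pc(2) pc(2) v])
  have "\<Phi> ^\<^sub>m k *\<^sub>v (power_gram \<Phi> {0..<k} *\<^sub>v y) =
      vec_sum n (\<lambda>l. \<Phi> ^\<^sub>m k *\<^sub>v (\<Phi> ^\<^sub>m l *\<^sub>v (mat_adjoint (\<Phi> ^\<^sub>m l) *\<^sub>v y))) {0..<k}"
    unfolding power_gram_mult_vec[OF y] using pc y
    by (intro mult_mat_vec_vec_sum) (auto intro!: mult_mat_vec_carrier)
  also have "\<dots> = vec_sum n (\<lambda>l. \<Phi> ^\<^sub>m (k + l) *\<^sub>v (mat_adjoint (\<Phi> ^\<^sub>m (k + l)) *\<^sub>v v)) {0..<k}"
    unfolding adj using pow_mat_add_mult_vec[OF mult_mat_vec_carrier[OF pc(2) y]] by simp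
  also have "\<dots> = power_gram \<Phi> {k..<2 * k} *\<^sub>v v"
  proof -
    have "(\<Sum>l = k..<2 * k. F l) = (\<Sum>l = 0..<k. F (k + l))" for F :: "nat \<Rightarrow> complex"
      using sum.shift_bounds_nat_ivl[of F 0 k k] by (simp add: mult_2 add.commute)
    then show ?thesis unfolding power_gram_mult_vec[OF v] vec_sum_def by simp
  qed
  finally show ?thesis unfolding y_def ..
qed

section \<open>Residuals of prescribed restriction\<close>

text \<open>The state \<open>q\<close> steps after a C-point with value zero, when step
  \<open>t\<close> is driven by the residual adj(\<Phi>^(k-1-t)) w. These residuals form the adjoint
  of the restriction over one interval applied to \<open>w\<close>, which is the shape of a
  least-norm solution.\<close>

primrec F_propagation :: "nat \<Rightarrow> complex vec \<Rightarrow> nat \<Rightarrow> complex vec" where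
  "F_propagation k w 0 = 0\<^sub>v n"
| "F_propagation k w (Suc q) = \<Phi> *\<^sub>v F_propagation k w q + mat_adjoint (\<Phi> ^\<^sub>m (k - Suc q)) *\<^sub>v w"

lemma F_propagation_carrier:
  "w \<in> carrier_vec n \<Longrightarrow> F_propagation k w q \<in> carrier_vec n"
  using \<Phi> pow_adjoint_carrier(2)
  by (induction q) (auto intro!: add_carrier_vec mult_mat_vec_carrier)

text \<open>Unrolls the recursion, with \<open>l\<close> counting the time steps an input has
  undergone since it entered.\<close>

lemma F_propagation_eq:
  assumes w: "w \<in> carrier_vec n" and "q \<le> k"
  shows "F_propagation k w q =
    vec_sum n (\<lambda>l. \<Phi> ^\<^sub>m l *\<^sub>v (mat_adjoint (\<Phi> ^\<^sub>m (k - q + l)) *\<^sub>v w)) {..<q}"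
  using \<open>q \<le> k\<close>
proof (induction q)
  case 0
  show ?case by (intro eq_vecI) (auto simp: vec_sum_def)
next
  case (Suc q)
  note pc = pow_adjoint_carrier
  let ?a = "\<lambda>l. mat_adjoint (\<Phi> ^\<^sub>m (k - q + l)) *\<^sub>v w"
  have a: "?a l \<in> carrier_vec n" for l using pc(2) w by (rule mult_mat_vec_carrier)
  have step: "\<Phi> *\<^sub>v (\<Phi> ^\<^sub>m l *\<^sub>v x) = \<Phi> ^\<^sub>m Suc l *\<^sub>v x" if "x \<in> carrier_vec n" for l x
    using pow_mat_add_mult_vec[OF that, of 1 l] \<Phi> by simp
  have "F_propagation k w q = vec_sum n (\<lambda>l. \<Phi> ^\<^sub>m l *\<^sub>v ?a l) {..<q}"
    using Suc by simp
  then have "\<Phi> *\<^sub>v F_propagation k w q = vec_sum n (\<lambda>l. \<Phi> *\<^sub>v (\<Phi> ^\<^sub>m l *\<^sub>v ?a l)) {..<q}"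
    using mult_mat_vec_vec_sum[OF \<Phi> mult_mat_vec_carrier[OF pc(1) a]] by simp
  also have "\<dots> = vec_sum n (\<lambda>l. \<Phi> ^\<^sub>m Suc l *\<^sub>v ?a l) {..<q}"
    unfolding step[OF a] ..
  finally have IH: "\<Phi> *\<^sub>v F_propagation k w q = vec_sum n (\<lambda>l. \<Phi> ^\<^sub>m Suc l *\<^sub>v ?a l) {..<q}" .
  \<comment> \<open>Subtraction is truncated; the identity relies on
    \<open>Suc q \<le> k\<close>.\<close>
  have idx: "k - q + l = k - Suc q + Suc l" for l using Suc.prems by simp
  have one: "\<Phi> ^\<^sub>m 0 *\<^sub>v (mat_adjoint (\<Phi> ^\<^sub>m (k - Suc q + 0)) *\<^sub>v w) =
      mat_adjoint (\<Phi> ^\<^sub>m (k - Suc q)) *\<^sub>v w"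
    using \<Phi> mult_mat_vec_carrier[OF pc(2) w] by simp
  show ?case
    unfolding F_propagation.simps(2) IH idx
  proof (intro eq_vecI)
    fix i assume "i < dim_vec (vec_sum n (\<lambda>l. \<Phi> ^\<^sub>m l *\<^sub>v
      (mat_adjoint (\<Phi> ^\<^sub>m (k - Suc q + l)) *\<^sub>v w)) {..<Suc q})"
    then have i: "i < n" by (simp add: vec_sum_def)
    then show "(vec_sum n (\<lambda>l. \<Phi> ^\<^sub>m Suc l *\<^sub>v (mat_adjoint (\<Phi> ^\<^sub>m (k - Suc q + Suc l)) *\<^sub>v w)) {..<q} +
        mat_adjoint (\<Phi> ^\<^sub>m (k - Suc q)) *\<^sub>v w) $ i =
      vec_sum n (\<lambda>l. \<Phi> ^\<^sub>m l *\<^sub>v (mat_adjoint (\<Phi> ^\<^sub>m (k - Suc q + l)) *\<^sub>v w)) {..<Suc q} $ i"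
      unfolding vec_sum_def sum.lessThan_Suc_shift one
      using carrier_vecD[OF mult_mat_vec_carrier[OF pc(2) w, of "k - Suc q"]]
      by (simp del: pow_mat.simps index_mult_mat_vec add: index_add_vec)
  qed (use \<Phi> in \<open>simp add: vec_sum_def\<close>)
qed

text \<open>After a full interval the exponents in front and in the adjoint agree, so the value
  reaching the next C-point is the Gramian applied to \<open>w\<close>.\<close>

lemma F_propagation_full:
  assumes w: "w \<in> carrier_vec n"
  shows "F_propagation k w k = power_gram \<Phi> {0..<k} *\<^sub>v w"
  unfolding power_gram_mult_vec[OF w] F_propagation_eq[OF w order_refl] by (simp add: lessThan_atLeast0)

text \<open>Each of the Nc - 1 intervals is driven separately: interval \<open>j\<close> uses
  \<open>w j\<close> and delivers its value at C-point j + 1, hence the shift by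
  \<open>case_nat\<close>. No interval precedes C-point 0, so \<open>f0\<close> is paid for in
  full.\<close>

lemma residual_restriction_preimage:
  assumes k: "k \<ge> 1" and Nc: "Nc \<ge> 1" and f0: "f0 \<in> carrier_vec n"
    and w: "\<And>j. w j \<in> carrier_vec n"
  shows "\<exists>r \<in> carrier_vec (dim_col (residual_restriction n Nc k \<Phi>)).
    residual_restriction n Nc k \<Phi> *\<^sub>v r =
      block_vec Nc n (case_nat f0 (\<lambda>j. power_gram \<Phi> {0..<k} *\<^sub>v w j)) \<and>
    (vec_l2norm r)\<^sup>2 = (vec_l2norm f0)\<^sup>2 +
      (\<Sum>j<Nc - 1. Re ((power_gram \<Phi> {0..<k} *\<^sub>v w j) \<bullet>c w j))"
proof -
  note pc = pow_adjoint_carrier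
  define f where "f = case_nat f0 (\<lambda>j. power_gram \<Phi> {0..<k} *\<^sub>v w j)"
  define \<mu> where "\<mu> p = F_propagation k (w (p div k)) (p mod k)" for p
  define \<rho> where "\<rho> p = (if p = 0 then \<mu> 0 else \<mu> p - \<Phi> *\<^sub>v \<mu> (p - 1)) +
    (if k dvd p then f (p div k) else 0\<^sub>v n)" for p
  have f: "f j \<in> carrier_vec n" for j
    unfolding f_def using f0 mult_mat_vec_carrier[OF power_gram_carrier w] by (cases j) auto
  have \<mu>: "\<mu> p \<in> carrier_vec n" for p unfolding \<mu>_def by (rule F_propagation_carrier[OF w])
  have \<mu>0: "\<mu> (j * k) = 0\<^sub>v n" for j by (simp add: \<mu>_def)
  have \<rho>0: "\<rho> 0 = f0" using \<mu>0[of 0] f0 by (simp add: \<rho>_def f_def)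
  \<comment> \<open>Inside an interval the recursion leaves just the new input. At its last step
    \<open>\<mu>\<close> is reset to zero, but the added \<open>f\<close> equals the unreset state,
    so the same formula results.\<close>
  have \<rho>: "\<rho> (Suc (j * k + t)) = mat_adjoint (\<Phi> ^\<^sub>m (k - Suc t)) *\<^sub>v w j" if t: "t < k" for j t
  proof -
    let ?P = "\<Phi> *\<^sub>v F_propagation k (w j) t" and ?a = "mat_adjoint (\<Phi> ^\<^sub>m (k - Suc t)) *\<^sub>v w j"
    have P: "?P \<in> carrier_vec n" using \<Phi> F_propagation_carrier[OF w] by (rule mult_mat_vec_carrier)
    have a: "?a \<in> carrier_vec n" using pc(2) w by (rule mult_mat_vec_carrier)
    have cancel: "(x + y - x) + 0\<^sub>v n = y" and cancel': "(0\<^sub>v n - x) + (x + y) = y"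
      if "x \<in> carrier_vec n" "y \<in> carrier_vec n" for x y :: "complex vec"
      using that by (auto intro!: eq_vecI)
    have prev: "\<mu> (j * k + t) = F_propagation k (w j) t" using t by (simp add: \<mu>_def)
    show ?thesis
    proof (cases "Suc t < k")
      case True
      have "Suc (j * k + t) div k = j"
        using True by (intro div_nat_eqI) (auto simp: algebra_simps)
      moreover have "Suc (j * k + t) mod k = Suc t"
        using True by (intro mod_nat_eqI) auto
      ultimately have "\<mu> (Suc (j * k + t)) = ?P + ?a" and "\<not> k dvd Suc (j * k + t)"
        by (simp_all add: \<mu>_def dvd_eq_mod_eq_0)
      then have "\<rho> (Suc (j * k + t)) = (?P + ?a - ?P) + 0\<^sub>v n"
        by (simp add: \<rho>_def prev)
      also have "\<dots> = ?a" by (rule cancel[OF P a])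
      finally show ?thesis .
    next
      case False
      then have kt: "k = Suc t" using t by simp
      then have p: "Suc (j * k + t) = Suc j * k" by simp
      have fj: "f (Suc j) = ?P + ?a"
        unfolding f_def using F_propagation_full[OF w, of k j] F_propagation.simps(2)[of k "w j" t]
        by (simp add: kt)
      have prev': "\<mu> (Suc j * k - 1) = F_propagation k (w j) t"
        using prev p by (metis diff_Suc_1)
      have "Suc j * k div k = Suc j" using k by simp
      then have "\<rho> (Suc j * k) = (\<mu> (Suc j * k) - \<Phi> *\<^sub>v \<mu> (Suc j * k - 1)) + f (Suc j)"
        using k by (simp add: \<rho>_def del: mult_Suc)
      then have "\<rho> (Suc j * k) = (0\<^sub>v n - ?P) + (?P + ?a)"
        unfolding prev' \<mu>0 fj .
      also have "\<dots> = ?a" by (rule cancel'[OF P a])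
      finally show ?thesis unfolding p .
    qed
  qed
  define u where "u = block_vec (num_points Nc k) n \<rho>"
  define r where "r = subvec u (F_dofs n k) @\<^sub>v subvec u (C_dofs n k)"
  have "residual_restriction n Nc k \<Phi> *\<^sub>v r = block_vec Nc n f"
    unfolding r_def u_def \<rho>_def[abs_def]
    by (rule residual_restriction_mult[where \<mu> = \<mu> and f = f, OF k Nc \<Phi> \<mu> \<mu>0 f])
  moreover have "r \<in> carrier_vec (dim_col (residual_restriction n Nc k \<Phi>))"
    by (intro carrier_vecI) (simp add: r_def u_def residual_restriction_dim_col card_C_dofs[OF k Nc])
  moreover have "(vec_l2norm r)\<^sup>2 = (vec_l2norm f0)\<^sup>2 +
      (\<Sum>j<Nc - 1. Re ((power_gram \<Phi> {0..<k} *\<^sub>v w j) \<bullet>c w j))"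
  proof -
    have \<rho>c: "\<rho> p \<in> carrier_vec n" for p
      unfolding \<rho>_def using \<mu> f \<Phi> by (auto intro!: add_carrier_vec minus_carrier_vec mult_mat_vec_carrier)
    have "(vec_l2norm r)\<^sup>2 = (vec_l2norm u)\<^sup>2"
      unfolding r_def using vec_l2norm_subvec_split[of u "F_dofs n k"] by (simp add: F_dofs_eq)
    also have "\<dots> = (\<Sum>p<Suc ((Nc - 1) * k). (vec_l2norm (\<rho> p))\<^sup>2)"
      unfolding u_def by (subst vec_l2norm_block_vec[OF \<rho>c]) (simp add: num_points_def)
    also have "\<dots> = (vec_l2norm f0)\<^sup>2 + (\<Sum>p<(Nc - 1) * k. (vec_l2norm (\<rho> (Suc p)))\<^sup>2)"
      unfolding sum.lessThan_Suc_shift \<rho>0 ..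
    also have "(\<Sum>p<(Nc - 1) * k. (vec_l2norm (\<rho> (Suc p)))\<^sup>2) =
        (\<Sum>j<Nc - 1. \<Sum>t<k. (vec_l2norm (mat_adjoint (\<Phi> ^\<^sub>m (k - Suc t)) *\<^sub>v w j))\<^sup>2)"
      unfolding sum_lessThan_mult using \<rho> by (intro sum.cong) auto
    also have "\<dots> = (\<Sum>j<Nc - 1. \<Sum>t<k. (vec_l2norm (mat_adjoint (\<Phi> ^\<^sub>m t) *\<^sub>v w j))\<^sup>2)"
      unfolding sum.nat_diff_reindex[of "\<lambda>t. (vec_l2norm (mat_adjoint (\<Phi> ^\<^sub>m t) *\<^sub>v w _))\<^sup>2" k] ..
    also have "\<dots> = (\<Sum>j<Nc - 1. Re ((power_gram \<Phi> {0..<k} *\<^sub>v w j) \<bullet>c w j))"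
      unfolding power_gram_quadratic_form[OF w] by (simp add: lessThan_atLeast0)
    finally show ?thesis .
  qed
  ultimately show ?thesis unfolding f_def by blast
qed

end

section \<open>The two-level operators\<close>

lemma coarse_error_carrier: "coarse_error n Nc k \<Phi> \<Psi> \<in> carrier_mat (Nc * n) (Nc * n)"
proof -
  have "B_Delta n Nc \<Psi> \<in> carrier_mat (Nc * n) (Nc * n)" "det (B_Delta n Nc \<Psi>) \<noteq> 0"
    by (simp_all add: B_Delta_def det_block_bidiag)
  then have "A_Delta n Nc k \<Phi> * mat_inv (B_Delta n Nc \<Psi>) \<in> carrier_mat (Nc * n) (Nc * n)"
    using mat_inv_det_nonzero(1) by (intro mult_carrier_mat[of _ _ "Nc * n"]) (auto simp: A_Delta_def)
  then show ?thesis unfolding coarse_error_def by (rule minus_carrier_mat)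
qed

lemma coarse_error_mult:
  assumes \<Phi>: "\<Phi> \<in> carrier_mat n n" and \<Psi>: "\<Psi> \<in> carrier_mat n n"
    and e: "\<And>j. e j \<in> carrier_vec n"
  shows "coarse_error n Nc k \<Phi> \<Psi> *\<^sub>v
      block_vec Nc n (\<lambda>j. if j = 0 then e 0 else e j - \<Psi> *\<^sub>v e (j - 1)) =
    block_vec Nc n (\<lambda>j. if j = 0 then 0\<^sub>v n else \<Phi> ^\<^sub>m k *\<^sub>v e (j - 1) - \<Psi> *\<^sub>v e (j - 1))"
proof -
  let ?A = "A_Delta n Nc k \<Phi>" and ?B = "B_Delta n Nc \<Psi>" and ?E = "block_vec Nc n e"
  let ?b = "\<lambda>j. if j = 0 then e 0 else e j - \<Psi> *\<^sub>v e (j - 1)"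
  let ?a = "\<lambda>j. if j = 0 then e 0 else e j - \<Phi> ^\<^sub>m k *\<^sub>v e (j - 1)"
  note pk = pow_adjoint_carrier(1)[OF \<Phi>, of k]
  have B: "?B \<in> carrier_mat (Nc * n) (Nc * n)" and det: "det ?B \<noteq> 0"
    and A: "?A \<in> carrier_mat (Nc * n) (Nc * n)"
    by (simp_all add: B_Delta_def A_Delta_def det_block_bidiag)
  note inv = mat_inv_det_nonzero(1)[OF B det]
  have BE: "block_vec Nc n ?b = ?B *\<^sub>v ?E"
    unfolding B_Delta_def by (rule block_bidiag_mult_block_vec[OF \<Psi> e, symmetric])
  have AE: "?A *\<^sub>v ?E = block_vec Nc n ?a"
    unfolding A_Delta_def by (rule block_bidiag_mult_block_vec[OF pk e])
  have "(?A * mat_inv ?B) *\<^sub>v (?B *\<^sub>v ?E) = ?A *\<^sub>v (mat_inv ?B *\<^sub>v (?B *\<^sub>v ?E))"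
    by (rule assoc_mult_mat_vec[OF A inv]) (simp add: B_Delta_def carrier_vecI)
  also have "\<dots> = block_vec Nc n ?a"
    unfolding mat_inv_mult_mat_vec_cancel(1)[OF B det block_vec_carrier] by (rule AE)
  finally have ABBE: "(?A * mat_inv ?B) *\<^sub>v block_vec Nc n ?b = block_vec Nc n ?a"
    unfolding BE .
  have "coarse_error n Nc k \<Phi> \<Psi> *\<^sub>v block_vec Nc n ?b =
      1\<^sub>m (Nc * n) *\<^sub>v block_vec Nc n ?b - (?A * mat_inv ?B) *\<^sub>v block_vec Nc n ?b"
    unfolding coarse_error_def
    by (rule minus_mult_distrib_mat_vec[OF one_carrier_mat mult_carrier_mat[OF A inv] block_vec_carrier])
  also have "\<dots> = block_vec Nc n ?b - block_vec Nc n ?a"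
    unfolding ABBE by simp
  also have "\<dots> = block_vec Nc n (\<lambda>j. if j = 0 then 0\<^sub>v n
      else \<Phi> ^\<^sub>m k *\<^sub>v e (j - 1) - \<Psi> *\<^sub>v e (j - 1))"
  proof (intro eq_vecI)
    fix i assume "i < dim_vec (block_vec Nc n (\<lambda>j. if j = 0 then 0\<^sub>v n
      else \<Phi> ^\<^sub>m k *\<^sub>v e (j - 1) - \<Psi> *\<^sub>v e (j - 1)))"
    then have i: "i < Nc * n" by simp
    then have "i mod n < n" by (cases n) auto
    then show "(block_vec Nc n ?b - block_vec Nc n ?a) $ i =
        block_vec Nc n (\<lambda>j. if j = 0 then 0\<^sub>v n
          else \<Phi> ^\<^sub>m k *\<^sub>v e (j - 1) - \<Psi> *\<^sub>v e (j - 1)) $ i"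
      using i carrier_vecD[OF mult_mat_vec_carrier[OF \<Psi> e]]
        carrier_vecD[OF mult_mat_vec_carrier[OF pk e]] carrier_vecD[OF e]
      by (simp add: block_vec_def del: dim_mult_mat_vec index_mult_mat_vec)
  qed simp
  finally show ?thesis .
qed

text \<open>\<open>B_Delta\<close> and \<open>A_Delta\<close> agree on block 0, so that output block
  is zero and \<open>e (Nc - 1)\<close> never enters. Agreement with \<open>f\<close> is asked only
  for \<open>j < Nc\<close> because the FCF sequence is cut off at the end.\<close>

lemma norm_coarse_error_mult:
  assumes \<Phi>: "\<Phi> \<in> carrier_mat n n" and \<Psi>: "\<Psi> \<in> carrier_mat n n"
    and e: "\<And>j. e j \<in> carrier_vec n" and Nc: "Nc \<ge> 1"
    and f: "\<And>j. j < Nc \<Longrightarrow> f j = (if j = 0 then e 0 else e j - \<Psi> *\<^sub>v e (j - 1))"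
  shows "(vec_l2norm (coarse_error n Nc k \<Phi> \<Psi> *\<^sub>v block_vec Nc n f))\<^sup>2 =
    (\<Sum>j<Nc - 1. (vec_l2norm ((\<Psi> - \<Phi> ^\<^sub>m k) *\<^sub>v e j))\<^sup>2)"
proof -
  note pk = pow_adjoint_carrier(1)[OF \<Phi>, of k]
  let ?h = "\<lambda>j. \<Phi> ^\<^sub>m k *\<^sub>v e j - \<Psi> *\<^sub>v e j"
  let ?g = "\<lambda>j. if j = 0 then 0\<^sub>v n else ?h (j - 1)"
  have carr: "\<Psi> *\<^sub>v e j \<in> carrier_vec n" "\<Phi> ^\<^sub>m k *\<^sub>v e j \<in> carrier_vec n" for j
    using \<Psi> pk e by (blast intro: mult_mat_vec_carrier)+
  have g: "?g j \<in> carrier_vec n" for j using carr by (auto intro!: minus_carrier_vec)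
  have h: "vec_l2norm (?h j) = vec_l2norm ((\<Psi> - \<Phi> ^\<^sub>m k) *\<^sub>v e j)" for j
    unfolding minus_mult_distrib_mat_vec[OF \<Psi> pk e] vec_l2norm_def
    using carrier_vecD[OF carr(1)] carrier_vecD[OF carr(2)]
    by (auto simp: norm_minus_commute simp del: dim_mult_mat_vec index_mult_mat_vec intro!: L2_set_cong)
  have "block_vec Nc n f = block_vec Nc n (\<lambda>j. if j = 0 then e 0 else e j - \<Psi> *\<^sub>v e (j - 1))"
    by (rule block_vec_cong[OF f])
  then have "coarse_error n Nc k \<Phi> \<Psi> *\<^sub>v block_vec Nc n f = block_vec Nc n ?g"
    using coarse_error_mult[OF \<Phi> \<Psi> e] by simp
  then have "(vec_l2norm (coarse_error n Nc k \<Phi> \<Psi> *\<^sub>v block_vec Nc n f))\<^sup>2 =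
      (\<Sum>j<Suc (Nc - 1). (vec_l2norm (?g j))\<^sup>2)"
    using vec_l2norm_block_vec[of Nc ?g n] g Nc by simp
  also have "\<dots> = (\<Sum>j<Nc - 1. (vec_l2norm (?h j))\<^sup>2)"
    unfolding sum.lessThan_Suc_shift by simp
  finally show ?thesis unfolding h .
qed

text \<open>The identity diagonal cancels and a nilpotent block shift times \<Phi>^k is left: the
  first output block is zero and the last input block is lost.\<close>

lemma one_minus_A_Delta_mult:
  assumes \<Phi>: "\<Phi> \<in> carrier_mat n n" and g: "\<And>j. g j \<in> carrier_vec n"
  shows "(1\<^sub>m (Nc * n) - A_Delta n Nc k \<Phi>) *\<^sub>v block_vec Nc n g =
    block_vec Nc n (\<lambda>j. if j = 0 then 0\<^sub>v n else \<Phi> ^\<^sub>m k *\<^sub>v g (j - 1))"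
proof -
  note pk = pow_adjoint_carrier(1)[OF \<Phi>, of k]
  have A: "A_Delta n Nc k \<Phi> \<in> carrier_mat (Nc * n) (Nc * n)" by (simp add: A_Delta_def)
  have "(1\<^sub>m (Nc * n) - A_Delta n Nc k \<Phi>) *\<^sub>v block_vec Nc n g =
      block_vec Nc n g - A_Delta n Nc k \<Phi> *\<^sub>v block_vec Nc n g"
    using minus_mult_distrib_mat_vec[OF one_carrier_mat A block_vec_carrier] by simp
  also have "A_Delta n Nc k \<Phi> *\<^sub>v block_vec Nc n g =
      block_vec Nc n (\<lambda>j. if j = 0 then g 0 else g j - \<Phi> ^\<^sub>m k *\<^sub>v g (j - 1))"
    unfolding A_Delta_def by (rule block_bidiag_mult_block_vec[OF pk g])
  also have "block_vec Nc n g - \<dots> =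
      block_vec Nc n (\<lambda>j. if j = 0 then 0\<^sub>v n else \<Phi> ^\<^sub>m k *\<^sub>v g (j - 1))"
  proof (intro eq_vecI)
    fix i assume "i < dim_vec (block_vec Nc n (\<lambda>j. if j = 0 then 0\<^sub>v n else \<Phi> ^\<^sub>m k *\<^sub>v g (j - 1)))"
    then have i: "i < Nc * n" by simp
    then have "i mod n < n" by (cases n) auto
    then show "(block_vec Nc n g -
        block_vec Nc n (\<lambda>j. if j = 0 then g 0 else g j - \<Phi> ^\<^sub>m k *\<^sub>v g (j - 1))) $ i =
        block_vec Nc n (\<lambda>j. if j = 0 then 0\<^sub>v n else \<Phi> ^\<^sub>m k *\<^sub>v g (j - 1)) $ i"
      using i carrier_vecD[OF mult_mat_vec_carrier[OF pk g]] carrier_vecD[OF g]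
      by (simp add: block_vec_def del: dim_mult_mat_vec index_mult_mat_vec)
  qed simp
  finally show ?thesis .
qed

lemma residual_restriction_carrier:
  assumes "k \<ge> 1" "Nc \<ge> 1"
  shows "residual_restriction n Nc k \<Phi> \<in>
    carrier_mat (Nc * n) (dim_col (residual_restriction n Nc k \<Phi>))"
  using A_cf_carrier[OF assms, of n \<Phi>]
  by (intro carrier_matI) (simp_all add: residual_restriction_def append_cols_def)

lemma norm_block_rows_mult:
  assumes E: "E \<in> carrier_mat m l" and P: "P \<in> carrier_mat l q" and r: "r \<in> carrier_vec q"
  shows "vec_l2norm (((0\<^sub>m a l @\<^sub>r E) * P) *\<^sub>v r) = vec_l2norm (E *\<^sub>v (P *\<^sub>v r))"
proof -
  have "((0\<^sub>m a l @\<^sub>r E) * P) *\<^sub>v r = (0\<^sub>m a l @\<^sub>r E) *\<^sub>v (P *\<^sub>v r)"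
    by (rule assoc_mult_mat_vec[OF carrier_append_rows[OF zero_carrier_mat E] P r])
  also have "\<dots> = 0\<^sub>v a @\<^sub>v (E *\<^sub>v (P *\<^sub>v r))"
    by (rule zero_append_rows_mult_vec[OF E mult_mat_vec_carrier[OF P r]])
  finally show ?thesis by simp
qed

lemma norm_R_F_mult:
  assumes "k \<ge> 1" "Nc \<ge> 1" "r \<in> carrier_vec (dim_col (residual_restriction n Nc k \<Phi>))"
  shows "vec_l2norm (R_F n Nc k \<Phi> \<Psi> *\<^sub>v r) =
    vec_l2norm (coarse_error n Nc k \<Phi> \<Psi> *\<^sub>v (residual_restriction n Nc k \<Phi> *\<^sub>v r))"
  unfolding R_F_def
  by (rule norm_block_rows_mult[OF coarse_error_carrier residual_restriction_carrier assms(3)])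
    (use assms in auto)

lemma norm_R_FCF_mult:
  assumes "k \<ge> 1" "Nc \<ge> 1" "r \<in> carrier_vec (dim_col (residual_restriction n Nc k \<Phi>))"
  shows "vec_l2norm (R_FCF n Nc k \<Phi> \<Psi> *\<^sub>v r) =
    vec_l2norm (coarse_error n Nc k \<Phi> \<Psi> *\<^sub>v ((1\<^sub>m (Nc * n) - A_Delta n Nc k \<Phi>) *\<^sub>v
      (residual_restriction n Nc k \<Phi> *\<^sub>v r)))"
proof -
  note E = coarse_error_carrier[of n Nc k \<Phi> \<Psi>] and P = residual_restriction_carrier[OF assms(1,2), of n \<Phi>]
  have A: "1\<^sub>m (Nc * n) - A_Delta n Nc k \<Phi> \<in> carrier_mat (Nc * n) (Nc * n)"
    by (intro minus_carrier_mat) (simp add: A_Delta_def)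
  show ?thesis
    unfolding R_FCF_def norm_block_rows_mult[OF mult_carrier_mat[OF E A] P assms(3)]
    by (subst assoc_mult_mat_vec[OF E A mult_mat_vec_carrier[OF P assms(3)]]) (rule refl)
qed

lemma dim_col_R [simp]:
  "dim_col (R_F n Nc k \<Phi> \<Psi>) = dim_col (residual_restriction n Nc k \<Phi>)"
  "dim_col (R_FCF n Nc k \<Phi> \<Psi>) = dim_col (residual_restriction n Nc k \<Phi>)"
  by (simp_all add: R_F_def R_FCF_def)

section \<open>The temporal approximation property\<close>

text \<open>Every condition on the constant is a non-strict linear inequality, so the set is closed.
  Since the minimum over phases is attained, a bound for each \<open>x\<close> puts \<open>K\<close>
  into the set; its infimum is therefore attained and at most \<open>K\<close>.\<close>

lemma tap_constants_minimum:
  assumes W: "mat_inv W \<in> carrier_mat n n" and \<Psi>: "\<Psi> \<in> carrier_mat n n" and K: "0 \<le> K"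
    and bound: "\<And>v x. v \<in> carrier_vec n \<Longrightarrow> vec_l2norm ((\<Psi> - \<Phi> ^\<^sub>m k) *\<^sub>v v)
      \<le> K * (shifted_norm n W \<Psi> v x + e * vec_l2norm v)"
  shows "\<exists>c. is_minimum c (tap_constants n k W \<Phi> \<Psi> e) \<and> K \<ge> c"
proof -
  let ?S = "tap_constants n k W \<Phi> \<Psi> e"
  have "vec_l2norm ((\<Psi> - \<Phi> ^\<^sub>m k) *\<^sub>v v) \<le> K * (min_shifted_norm n W \<Psi> v + e * vec_l2norm v)"
    if v: "v \<in> carrier_vec n" for v
    using bound[OF v] min_shifted_norm_attained[OF W \<Psi> v] by metis
  then have KS: "K \<in> ?S" using K by (simp add: tap_constants_def)
  have S: "?S = {0..} \<inter> (\<Inter>v\<in>carrier_vec n. {c. vec_l2norm ((\<Psi> - \<Phi> ^\<^sub>m k) *\<^sub>v v)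
      \<le> c * (min_shifted_norm n W \<Psi> v + e * vec_l2norm v)})"
    by (auto simp: tap_constants_def)
  have "closed ?S"
    unfolding S by (intro closed_Int closed_INT ballI closed_Collect_le closed_atLeast continuous_intros)
  moreover have bdd: "bdd_below ?S" by (auto simp: tap_constants_def intro: bdd_belowI)
  ultimately have "Inf ?S \<in> ?S" using KS closed_contains_Inf by blast
  then have "is_minimum (Inf ?S) ?S" "Inf ?S \<le> K"
    using bdd KS by (auto simp: is_minimum_def intro: cInf_lower)
  then show ?thesis by blast
qed

text \<open>With \<open>m\<close> blocks, initial cost factor \<open>c\<close> and \<open>b\<close>
  the norm of v, dividing by \<open>m\<close> leaves s^2 + e^2 b^2 on the right, which is at most (s
  + e b)^2 because the cross term is nonnegative.\<close>

lemma le_of_mean_square_le: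
  fixes a b c e s K m :: real
  assumes "0 < m" "0 \<le> b" "0 \<le> e" "0 \<le> s" "0 \<le> K"
    and main: "m * a\<^sup>2 \<le> K\<^sup>2 * (c * b\<^sup>2 + m * s\<^sup>2)" and c: "c \<le> m * e\<^sup>2"
  shows "a \<le> K * (s + e * b)"
proof -
  have "c * b\<^sup>2 + m * s\<^sup>2 \<le> m * e\<^sup>2 * b\<^sup>2 + m * s\<^sup>2"
    using c by (intro add_right_mono mult_right_mono) auto
  also have "\<dots> \<le> m * (s + e * b)\<^sup>2"
    using assms by (simp add: power2_sum power_mult_distrib algebra_simps)
  finally have "m * a\<^sup>2 \<le> K\<^sup>2 * (m * (s + e * b)\<^sup>2)"
    using main by (meson mult_left_mono order_trans zero_le_power2)
  also have "\<dots> = m * (K * (s + e * b))\<^sup>2" by (simp only: power_mult_distrib mult_ac)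
  finally have "a\<^sup>2 \<le> (K * (s + e * b))\<^sup>2" using \<open>0 < m\<close> by simp
  moreover have "0 \<le> K * (s + e * b)" using assms(2-5) by simp
  ultimately show ?thesis by (rule power2_le_imp_le)
qed

text \<open>For \<open>m = Nc - 2\<close> the hypothesis says exactly \<open>Nc \<ge> 3\<close>.
  Using \<open>Nc + 1\<close> under the root keeps the quotient positive at \<open>Nc = 0\<close>,
  where division by zero would give 0.\<close>

lemma two_div_sqrt_power2:
  assumes "4 * m \<ge> real Nc + 1"
  shows "C\<^sup>2 \<le> m * (C * (2 / sqrt (real Nc + 1)))\<^sup>2"
proof -
  have "m * (C * (2 / sqrt (real Nc + 1)))\<^sup>2 = C\<^sup>2 * (4 * m / (real Nc + 1))"
    by (simp add: power_mult_distrib power_divide)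
  moreover have "C\<^sup>2 * 1 \<le> C\<^sup>2 * (4 * m / (real Nc + 1))"
    using assms by (intro mult_left_mono) auto
  ultimately show ?thesis by simp
qed

lemma two_div_sqrt_bigo: "(\<lambda>Nc. C * (2 / sqrt (real Nc + 1))) \<in> O(\<lambda>Nc. 1 / sqrt (real Nc))"
proof (rule bigoI[of _ "2 * \<bar>C\<bar>"])
  have "norm (C * (2 / sqrt (real Nc + 1))) \<le> 2 * \<bar>C\<bar> * norm (1 / sqrt (real Nc))" if "Nc > 0" for Nc
  proof -
    have "2 * \<bar>C\<bar> / sqrt (real Nc + 1) \<le> 2 * \<bar>C\<bar> / sqrt (real Nc)"
      using that by (intro divide_left_mono) auto
    then show ?thesis by (simp add: abs_mult mult.commute)
  qed
  then show "\<forall>\<^sub>F Nc in at_top. norm (C * (2 / sqrt (real Nc + 1))) \<le> 2 * \<bar>C\<bar> * norm (1 / sqrt (real Nc))"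
    by (auto simp: eventually_at_top_dense intro: exI[of _ 0])
qed

text \<open>\<open>y\<close> is G^-1 z written through the root W, so that <G y, y> = |W y|^2 =
  |W^-1 z|^2: the cost of a least-norm preimage becomes the norm in the approximation
  property.\<close>

lemma psd_sqrt_inverse_twice:
  assumes G: "psd_mat n G" and det: "det (psd_sqrt G) \<noteq> 0" and z: "z \<in> carrier_vec n"
  defines "y \<equiv> mat_inv (psd_sqrt G) *\<^sub>v (mat_inv (psd_sqrt G) *\<^sub>v z)"
  shows "y \<in> carrier_vec n" "G *\<^sub>v y = z"
    "Re ((G *\<^sub>v y) \<bullet>c y) = (vec_l2norm (mat_inv (psd_sqrt G) *\<^sub>v z))\<^sup>2"
proof -
  let ?W = "psd_sqrt G"
  have Wc: "?W \<in> carrier_mat n n" and Wa: "mat_adjoint ?W = ?W" and WW: "?W * ?W = G"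
    using psd_sqrt_psd[OF G] by (auto simp: psd_mat_def)
  note inv = mat_inv_det_nonzero(1)[OF Wc det]
  define u where "u = mat_inv ?W *\<^sub>v z"
  have u: "u \<in> carrier_vec n" unfolding u_def using inv z by (rule mult_mat_vec_carrier)
  show y: "y \<in> carrier_vec n" unfolding y_def u_def[symmetric] using inv u by (rule mult_mat_vec_carrier)
  have Wy: "?W *\<^sub>v y = u" unfolding y_def u_def[symmetric]
    by (rule mat_inv_mult_mat_vec_cancel(2)[OF Wc det u])
  have Gy: "G *\<^sub>v y = ?W *\<^sub>v u"
    using assoc_mult_mat_vec[OF Wc Wc y] unfolding WW Wy .
  then show "G *\<^sub>v y = z"
    unfolding u_def using mat_inv_mult_mat_vec_cancel(2)[OF Wc det z] by simp
  have "(G *\<^sub>v y) \<bullet>c y = u \<bullet>c u"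
    unfolding Gy cscalar_mult_mat_vec[OF Wc u y] Wa Wy ..
  then show "Re ((G *\<^sub>v y) \<bullet>c y) = (vec_l2norm (mat_inv ?W *\<^sub>v z))\<^sup>2"
    by (simp add: cscalar_self u_def del: of_real_power)
qed

text \<open>The summand l = 0 of the Gramian is the identity, and \<open>k \<ge> 1\<close> ensures
  that it occurs; a kernel vector would then have norm zero.\<close>

lemma det_W_F:
  assumes k: "k \<ge> 1" and \<Phi>: "\<Phi> \<in> carrier_mat n n"
  shows "det (W_F k \<Phi>) \<noteq> 0"
proof
  let ?G = "power_gram \<Phi> {0..<k}"
  assume det0: "det (W_F k \<Phi>) = 0"
  note G = psd_power_gram[OF \<Phi>, of "{0..<k}"]
  have W: "W_F k \<Phi> \<in> carrier_mat n n" and WW: "W_F k \<Phi> * W_F k \<Phi> = ?G"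
    using psd_sqrt_psd[OF G] by (auto simp: W_F_def psd_mat_def)
  obtain v where v: "v \<in> carrier_vec n" "v \<noteq> 0\<^sub>v n" and Wv: "W_F k \<Phi> *\<^sub>v v = 0\<^sub>v n"
    using det_0_iff_vec_prod_zero_field[OF W] det0 by blast
  have "W_F k \<Phi> *\<^sub>v 0\<^sub>v n = 0\<^sub>v n" using W by (intro eq_vecI) (auto simp: scalar_prod_def)
  then have "?G *\<^sub>v v = 0\<^sub>v n" using assoc_mult_mat_vec[OF W W v(1)] unfolding WW Wv by simp
  then have "(\<Sum>l = 0..<k. (vec_l2norm (mat_adjoint (\<Phi> ^\<^sub>m l) *\<^sub>v v))\<^sup>2) = 0"
    using power_gram_quadratic_form[OF \<Phi> v(1), of "{0..<k}"] v(1)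
    by (simp del: of_real_sum of_real_power)
  then have all: "\<forall>l \<in> {0..<k}. (vec_l2norm (mat_adjoint (\<Phi> ^\<^sub>m l) *\<^sub>v v))\<^sup>2 = 0"
    by (subst (asm) sum_nonneg_eq_0_iff) auto
  have "(vec_l2norm (mat_adjoint (\<Phi> ^\<^sub>m 0) *\<^sub>v v))\<^sup>2 = 0"
    by (rule bspec[OF all]) (use k in simp)
  then have "vec_l2norm v = 0" using v(1) carrier_matD[OF \<Phi>] by simp
  then show False using vec_l2norm_eq_0 v by blast
qed

lemma W_FCF_invertible:
  assumes \<Phi>: "\<Phi> \<in> carrier_mat n n" and inv: "invertible_mat (W_FCF k \<Phi>)"
  shows "W_FCF k \<Phi> \<in> carrier_mat n n" "det (W_FCF k \<Phi>) \<noteq> 0"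
proof -
  let ?W = "W_FCF k \<Phi>"
  show W: "?W \<in> carrier_mat n n"
    using psd_sqrt_psd[OF psd_power_gram[OF \<Phi>]] by (auto simp: W_FCF_def psd_mat_def)
  obtain B where B: "?W * B = 1\<^sub>m n" "B * ?W = 1\<^sub>m (dim_row B)"
    using inv W by (auto simp: invertible_mat_def inverts_mat_def)
  have "B \<in> carrier_mat n n"
    using arg_cong[OF B(1), of dim_col] arg_cong[OF B(2), of dim_col] W
    by (intro carrier_matI) auto
  then show "det ?W \<noteq> 0" using det_mult[OF W] B(1) by fastforce
qed

lemma vec_l2norm_cis_smult: "vec_l2norm (cis t \<cdot>\<^sub>v v) = vec_l2norm v"
  by (simp add: vec_l2norm_smult)

lemma shifted_norm_cis_smult:
  assumes "mat_inv W \<in> carrier_mat n n" "\<Psi> \<in> carrier_mat n n" "v \<in> carrier_vec n"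
  shows "vec_l2norm (mat_inv W *\<^sub>v
      (cis t \<cdot>\<^sub>v ((1\<^sub>m n - exp (\<i> * complex_of_real x) \<cdot>\<^sub>m \<Psi>) *\<^sub>v v))) = shifted_norm n W \<Psi> v x"
proof -
  have "(1\<^sub>m n - exp (\<i> * complex_of_real x) \<cdot>\<^sub>m \<Psi>) *\<^sub>v v \<in> carrier_vec n"
    using assms by (intro mult_mat_vec_carrier minus_carrier_mat) auto
  from mult_mat_vec[OF assms(1) this] show ?thesis
    by (simp add: shifted_norm_def vec_l2norm_cis_smult)
qed

lemma cis_shift:
  assumes \<Psi>: "\<Psi> \<in> carrier_mat n n" and v: "v \<in> carrier_vec n"
  shows "cis (- (real (Suc j) * x)) \<cdot>\<^sub>v ((1\<^sub>m n - exp (\<i> * complex_of_real x) \<cdot>\<^sub>m \<Psi>) *\<^sub>v v) =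
    cis (- (real (Suc j) * x)) \<cdot>\<^sub>v v - \<Psi> *\<^sub>v (cis (- (real j * x)) \<cdot>\<^sub>v v)"
proof -
  have phase: "cis (- (real (Suc j) * x)) * exp (\<i> * complex_of_real x) = cis (- (real j * x))"
    by (simp add: cis_mult algebra_simps flip: cis_conv_exp)
  have \<Psi>v: "\<Psi> *\<^sub>v v \<in> carrier_vec n" using \<Psi> v by (rule mult_mat_vec_carrier)
  have scaled: "(a \<cdot>\<^sub>m \<Psi>) *\<^sub>v v = a \<cdot>\<^sub>v (\<Psi> *\<^sub>v v)" for a
    using \<Psi> v by (intro eq_vecI) auto
  have "(1\<^sub>m n - a \<cdot>\<^sub>m \<Psi>) *\<^sub>v v = v - a \<cdot>\<^sub>v (\<Psi> *\<^sub>v v)" for a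
    using minus_mult_distrib_mat_vec[OF one_carrier_mat smult_carrier_mat[OF \<Psi>] v, of a] v
    by (simp add: scaled)
  then show ?thesis
    unfolding mult_mat_vec[OF \<Psi> v] phase[symmetric] using v \<Psi>v
    by (intro eq_vecI) (auto simp: algebra_simps carrier_matD[OF \<Psi>] simp del: index_mult_mat_vec)
qed

section \<open>The estimates for F- and FCF-relaxation\<close>

lemma F_bound:
  assumes k: "k \<ge> 1" and \<Phi>: "\<Phi> \<in> carrier_mat n n" and \<Psi>: "\<Psi> \<in> carrier_mat n n"
    and Nc: "Nc \<ge> 3" and v: "v \<in> carrier_vec n"
  shows "vec_l2norm ((\<Psi> - \<Phi> ^\<^sub>m k) *\<^sub>v v) \<le> mat_opnorm (R_F n Nc k \<Phi> \<Psi>) *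
    (shifted_norm n (W_F k \<Phi>) \<Psi> v x + 2 / sqrt (real Nc + 1) * vec_l2norm v)"
proof -
  let ?G = "power_gram \<Phi> {0..<k}" and ?W = "W_F k \<Phi>" and ?R = "R_F n Nc k \<Phi> \<Psi>"
  have Nc1: "Nc \<ge> 1" using Nc by simp
  note G = psd_power_gram[OF \<Phi>, of "{0..<k}"]
  have det: "det (psd_sqrt ?G) \<noteq> 0" using det_W_F[OF k \<Phi>] by (simp add: W_F_def)
  have W: "?W \<in> carrier_mat n n" using psd_sqrt_psd[OF G] by (auto simp: W_F_def psd_mat_def)
  note inv = mat_inv_det_nonzero(1)[OF W det_W_F[OF k \<Phi>]]
  define z where "z = (1\<^sub>m n - exp (\<i> * complex_of_real x) \<cdot>\<^sub>m \<Psi>) *\<^sub>v v"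
  have z: "z \<in> carrier_vec n" unfolding z_def using \<Psi> v
    by (intro mult_mat_vec_carrier minus_carrier_mat) auto
  define c where "c j = cis (- (real j * x))" for j
  define e where "e j = c j \<cdot>\<^sub>v v" for j
  \<comment> \<open>G^-1 applied to the value wanted at C-point j + 1, where interval
    \<open>j\<close> ends.\<close>
  define w where "w j = mat_inv ?W *\<^sub>v (mat_inv ?W *\<^sub>v (c (Suc j) \<cdot>\<^sub>v z))" for j
  have e: "e j \<in> carrier_vec n" for j using v by (simp add: e_def)
  have cz: "c j \<cdot>\<^sub>v z \<in> carrier_vec n" for j using z by simp
  have w: "w j \<in> carrier_vec n" and Gw: "?G *\<^sub>v w j = c (Suc j) \<cdot>\<^sub>v z"
    and quad: "Re ((?G *\<^sub>v w j) \<bullet>c w j) = (shifted_norm n ?W \<Psi> v x)\<^sup>2" for j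
    using psd_sqrt_inverse_twice[OF G det cz[of "Suc j"]]
      shifted_norm_cis_smult[OF inv \<Psi> v, of "- (real (Suc j) * x)" x]
    unfolding w_def W_F_def z_def c_def by auto
  obtain r where r: "r \<in> carrier_vec (dim_col (residual_restriction n Nc k \<Phi>))"
    and Pr: "residual_restriction n Nc k \<Phi> *\<^sub>v r = block_vec Nc n (case_nat v (\<lambda>j. ?G *\<^sub>v w j))"
    and nr: "(vec_l2norm r)\<^sup>2 = (vec_l2norm v)\<^sup>2 + (\<Sum>j<Nc - 1. Re ((?G *\<^sub>v w j) \<bullet>c w j))"
    using residual_restriction_preimage[where w = w, OF \<Phi> k Nc1 v w] by blast
  have f: "case_nat v (\<lambda>j. ?G *\<^sub>v w j) j = (if j = 0 then e 0 else e j - \<Psi> *\<^sub>v e (j - 1))" for j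
    using cis_shift[OF \<Psi> v, of "j - 1" x] v
    by (cases j) (simp_all add: Gw e_def c_def z_def del: of_nat_Suc)
  have Dv: "vec_l2norm ((\<Psi> - \<Phi> ^\<^sub>m k) *\<^sub>v e j) = vec_l2norm ((\<Psi> - \<Phi> ^\<^sub>m k) *\<^sub>v v)" for j
    unfolding e_def mult_mat_vec[OF minus_carrier_mat[OF pow_adjoint_carrier(1)[OF \<Phi>]] v]
    by (simp add: c_def vec_l2norm_cis_smult)
  have "(vec_l2norm (?R *\<^sub>v r))\<^sup>2 = real (Nc - 1) * (vec_l2norm ((\<Psi> - \<Phi> ^\<^sub>m k) *\<^sub>v v))\<^sup>2"
    unfolding norm_R_F_mult[OF k Nc1 r] Pr norm_coarse_error_mult[where e = e, OF \<Phi> \<Psi> e Nc1 f]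
    by (simp add: Dv)
  moreover have "(vec_l2norm (?R *\<^sub>v r))\<^sup>2 \<le> (mat_opnorm ?R * vec_l2norm r)\<^sup>2"
    using vec_l2norm_mult_mat_vec_le[of r ?R] r by (intro power_mono) auto
  moreover have "(vec_l2norm r)\<^sup>2 =
      1 * (vec_l2norm v)\<^sup>2 + real (Nc - 1) * (shifted_norm n ?W \<Psi> v x)\<^sup>2"
    unfolding nr quad by simp
  ultimately have main: "real (Nc - 1) * (vec_l2norm ((\<Psi> - \<Phi> ^\<^sub>m k) *\<^sub>v v))\<^sup>2 \<le>
      (mat_opnorm ?R)\<^sup>2 * (1 * (vec_l2norm v)\<^sup>2 + real (Nc - 1) * (shifted_norm n ?W \<Psi> v x)\<^sup>2)"
    by (simp add: power_mult_distrib)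
  \<comment> \<open>The cost factor is 1 because the initial block is \<open>e 0 = v\<close>
    itself.\<close>
  have small: "1 \<le> real (Nc - 1) * (2 / sqrt (real Nc + 1))\<^sup>2"
    using two_div_sqrt_power2[of Nc "real (Nc - 1)" 1] Nc by simp
  show ?thesis
    by (rule le_of_mean_square_le[OF _ _ _ _ _ main small])
      (use Nc in \<open>auto simp: mat_opnorm_nonneg shifted_norm_def\<close>)
qed

text \<open>\<open>C\<close> is chosen before \<open>Nc\<close>, \<open>v\<close> and
  \<open>x\<close>; this uniformity is what makes the additive term O(1 / sqrt Nc).\<close>

lemma FCF_bound:
  assumes k: "k \<ge> 1" and \<Phi>: "\<Phi> \<in> carrier_mat n n"
    and inv: "invertible_mat (W_FCF k \<Phi>)"
  shows "\<exists>C > 0. \<forall>\<Psi> \<in> carrier_mat n n. \<forall>Nc \<ge> 3. \<forall>v \<in> carrier_vec n. \<forall>x.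
    vec_l2norm ((\<Psi> - \<Phi> ^\<^sub>m k) *\<^sub>v v) \<le> mat_opnorm (R_FCF n Nc k \<Phi> \<Psi>) *
      (shifted_norm n (W_FCF k \<Phi>) \<Psi> v x + C * (2 / sqrt (real Nc + 1)) * vec_l2norm v)"
proof -
  let ?G = "power_gram \<Phi> {0..<k}" and ?G2 = "power_gram \<Phi> {k..<2 * k}" and ?W = "W_FCF k \<Phi>"
  let ?P = "\<Phi> ^\<^sub>m k"
  note G2 = psd_power_gram[OF \<Phi>, of "{k..<2 * k}"] and Gc = power_gram_carrier[OF \<Phi>, of "{0..<k}"]
    and P = pow_adjoint_carrier(1)[OF \<Phi>, of k] and Pa = pow_adjoint_carrier(2)[OF \<Phi>, of k]
  note W = W_FCF_invertible(1)[OF \<Phi> inv] and det' = W_FCF_invertible(2)[OF \<Phi> inv]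
  have det: "det (psd_sqrt ?G2) \<noteq> 0" using det' by (simp add: W_FCF_def)
  note Wi = mat_inv_det_nonzero(1)[OF W det']
  \<comment> \<open>A right inverse of \<Phi>^k, namely G adj(\<Phi>^k) (\<Phi>^k G
    adj(\<Phi>^k))^-1. The initial block must satisfy \<Phi>^k f0 = \<open>e 1\<close>, because
    \<open>e 0 = 0\<close>.\<close>
  define L where "L = ?G * (mat_adjoint ?P * (mat_inv ?W * mat_inv ?W))"
  have Lc: "L \<in> carrier_mat n n"
    unfolding L_def by (intro mult_carrier_mat[OF Gc] mult_carrier_mat[OF Pa] mult_carrier_mat[OF Wi] Wi)
  have L: "L *\<^sub>v u = ?G *\<^sub>v (mat_adjoint ?P *\<^sub>v (mat_inv ?W *\<^sub>v (mat_inv ?W *\<^sub>v u)))"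
    if u: "u \<in> carrier_vec n" for u
    unfolding L_def assoc_mult_mat_vec[OF Gc mult_carrier_mat[OF Pa mult_carrier_mat[OF Wi Wi]] u]
      assoc_mult_mat_vec[OF Pa mult_carrier_mat[OF Wi Wi] u] assoc_mult_mat_vec[OF Wi Wi u] ..
  obtain K0 where "\<forall>u \<in> carrier_vec (dim_col L). vec_l2norm (L *\<^sub>v u) \<le> K0 * vec_l2norm u"
    using mult_mat_vec_bounded by blast
  then have K0: "vec_l2norm (L *\<^sub>v u) \<le> K0 * vec_l2norm u" if "u \<in> carrier_vec n" for u
    using that Lc by auto
  \<comment> \<open>The summand 1 makes \<open>C\<close> strictly positive, as required of the
    function \<epsilon>.\<close>
  define C where "C = \<bar>K0\<bar> + 1"
  have C: "vec_l2norm (L *\<^sub>v u) \<le> C * vec_l2norm u" if "u \<in> carrier_vec n" for u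
  proof -
    have "K0 * vec_l2norm u \<le> C * vec_l2norm u" unfolding C_def by (intro mult_right_mono) auto
    then show ?thesis using K0[OF that] by linarith
  qed
  have "vec_l2norm ((\<Psi> - ?P) *\<^sub>v v) \<le> mat_opnorm (R_FCF n Nc k \<Phi> \<Psi>) *
      (shifted_norm n ?W \<Psi> v x + C * (2 / sqrt (real Nc + 1)) * vec_l2norm v)"
    if \<Psi>: "\<Psi> \<in> carrier_mat n n" and Nc: "Nc \<ge> 3" and v: "v \<in> carrier_vec n" for \<Psi> Nc v x
  proof -
    let ?R = "R_FCF n Nc k \<Phi> \<Psi>"
    have Nc1: "Nc \<ge> 1" using Nc by simp
    define z where "z = (1\<^sub>m n - exp (\<i> * complex_of_real x) \<cdot>\<^sub>m \<Psi>) *\<^sub>v v"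
    have z: "z \<in> carrier_vec n" unfolding z_def using \<Psi> v
      by (intro mult_mat_vec_carrier minus_carrier_mat) auto
    define c where "c j = cis (- (real j * x))" for j
    define e where "e j = (if j = 0 then 0\<^sub>v n else c j \<cdot>\<^sub>v v)" for j
    \<comment> \<open>The phase index has two successors: interval \<open>j\<close> ends at C-point
      j + 1, and \<open>I - A_Delta\<close> moves its value on to block j + 2.\<close>
    define y where "y j = mat_inv ?W *\<^sub>v (mat_inv ?W *\<^sub>v (c (Suc (Suc j)) \<cdot>\<^sub>v z))" for j
    \<comment> \<open>The last interval feeds only the block discarded by the shift, so its residual
      is set to zero and costs nothing.\<close>
    define w where "w j = (if j < Nc - 2 then mat_adjoint ?P *\<^sub>v y j else 0\<^sub>v n)" for j
    define f0 where "f0 = L *\<^sub>v (c 1 \<cdot>\<^sub>v v)"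
    define f where "f = case_nat f0 (\<lambda>j. ?G *\<^sub>v w j)"
    have e: "e j \<in> carrier_vec n" for j using v by (simp add: e_def)
    have cz: "c j \<cdot>\<^sub>v z \<in> carrier_vec n" and cv: "c j \<cdot>\<^sub>v v \<in> carrier_vec n" for j
      using z v by auto
    have y: "y j \<in> carrier_vec n" and G2y: "?G2 *\<^sub>v y j = c (Suc (Suc j)) \<cdot>\<^sub>v z"
      and quad: "Re ((?G2 *\<^sub>v y j) \<bullet>c y j) = (shifted_norm n ?W \<Psi> v x)\<^sup>2" for j
      using psd_sqrt_inverse_twice[OF G2 det cz[of "Suc (Suc j)"]]
        shifted_norm_cis_smult[OF Wi \<Psi> v, of "- (real (Suc (Suc j)) * x)" x]
      unfolding y_def W_FCF_def z_def c_def by auto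
    have Py: "mat_adjoint ?P *\<^sub>v y j \<in> carrier_vec n" for j using Pa y by (rule mult_mat_vec_carrier)
    have w: "w j \<in> carrier_vec n" for j using Py by (simp add: w_def)
    have f0: "f0 \<in> carrier_vec n" unfolding f0_def using Lc cv by (rule mult_mat_vec_carrier)
    have fc: "f j \<in> carrier_vec n" for j
      unfolding f_def using f0 mult_mat_vec_carrier[OF Gc w] by (cases j) auto
    obtain r where r: "r \<in> carrier_vec (dim_col (residual_restriction n Nc k \<Phi>))"
      and Pr: "residual_restriction n Nc k \<Phi> *\<^sub>v r = block_vec Nc n f"
      and nr: "(vec_l2norm r)\<^sup>2 = (vec_l2norm f0)\<^sup>2 + (\<Sum>j<Nc - 1. Re ((?G *\<^sub>v w j) \<bullet>c w j))"
      using residual_restriction_preimage[where w = w, OF \<Phi> k Nc1 f0 w] unfolding f_def by blast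
    have Pf0: "?P *\<^sub>v f0 = c 1 \<cdot>\<^sub>v v"
      using power_gram_shift_mult_vec[OF \<Phi> psd_sqrt_inverse_twice(1)[OF G2 det cv[of 1]], of k]
        psd_sqrt_inverse_twice(2)[OF G2 det cv[of 1]]
      unfolding f0_def L[OF cv] W_FCF_def by simp
    have PGy: "?P *\<^sub>v (?G *\<^sub>v (mat_adjoint ?P *\<^sub>v y j)) = c (Suc (Suc j)) \<cdot>\<^sub>v z" for j
      unfolding power_gram_shift_mult_vec[OF \<Phi> y, symmetric] by (rule G2y)
    have g: "(if j = 0 then 0\<^sub>v n else ?P *\<^sub>v f (j - 1)) =
        (if j = 0 then e 0 else e j - \<Psi> *\<^sub>v e (j - 1))" if j: "j < Nc" for j
    proof -
      consider "j = 0" | "j = 1" | i where "j = Suc (Suc i)" by (metis One_nat_def not0_implies_Suc)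
      then show ?thesis
      proof cases
        case 1
        then show ?thesis by (simp add: e_def)
      next
        case 2
        have "\<Psi> *\<^sub>v 0\<^sub>v n = 0\<^sub>v n" using \<Psi> by (intro eq_vecI) (auto simp: scalar_prod_def)
        moreover have "c 1 \<cdot>\<^sub>v v - 0\<^sub>v n = c 1 \<cdot>\<^sub>v v" using v by (intro eq_vecI) auto
        ultimately show ?thesis using 2 Pf0 by (simp add: f_def e_def)
      next
        case 3
        then have "i < Nc - 2" using j by simp
        then have "?P *\<^sub>v f (j - 1) = c (Suc (Suc i)) \<cdot>\<^sub>v z"
          using PGy[of i] 3 by (simp add: f_def w_def)
        also have "\<dots> = c (Suc (Suc i)) \<cdot>\<^sub>v v - \<Psi> *\<^sub>v (c (Suc i) \<cdot>\<^sub>v v)"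
          unfolding c_def z_def by (rule cis_shift[OF \<Psi> v])
        finally show ?thesis using 3 by (simp add: e_def)
      qed
    qed
    have De: "vec_l2norm ((\<Psi> - ?P) *\<^sub>v e (Suc j)) = vec_l2norm ((\<Psi> - ?P) *\<^sub>v v)" for j
      unfolding e_def using mult_mat_vec[OF minus_carrier_mat[OF P] v, of \<Psi>]
      by (simp add: c_def vec_l2norm_cis_smult del: of_nat_Suc)
    have "(\<Psi> - ?P) *\<^sub>v 0\<^sub>v n = 0\<^sub>v n"
      using minus_carrier_mat[OF P, of \<Psi>] by (intro eq_vecI) (auto simp: scalar_prod_def)
    then have De0: "vec_l2norm ((\<Psi> - ?P) *\<^sub>v e 0) = 0" by (simp add: e_def)
    have N1: "Nc - 1 = Suc (Nc - 2)" using Nc by simp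
    have "(vec_l2norm (?R *\<^sub>v r))\<^sup>2 = (\<Sum>j<Nc - 1. (vec_l2norm ((\<Psi> - ?P) *\<^sub>v e j))\<^sup>2)"
      unfolding norm_R_FCF_mult[OF k Nc1 r] Pr one_minus_A_Delta_mult[OF \<Phi> fc]
      by (rule norm_coarse_error_mult[where e = e, OF \<Phi> \<Psi> e Nc1 g])
    \<comment> \<open>The term of \<open>e 0 = 0\<close> drops out, which matches the number of
      intervals paid for.\<close>
    also have "\<dots> = real (Nc - 2) * (vec_l2norm ((\<Psi> - ?P) *\<^sub>v v))\<^sup>2"
      unfolding N1 sum.lessThan_Suc_shift De De0 by simp
    finally have "real (Nc - 2) * (vec_l2norm ((\<Psi> - ?P) *\<^sub>v v))\<^sup>2 = (vec_l2norm (?R *\<^sub>v r))\<^sup>2" ..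
    also have "\<dots> \<le> (mat_opnorm ?R * vec_l2norm r)\<^sup>2"
      using vec_l2norm_mult_mat_vec_le[of r ?R] r by (intro power_mono) auto
    also have "\<dots> = (mat_opnorm ?R)\<^sup>2 * (vec_l2norm r)\<^sup>2" by (simp add: power_mult_distrib)
    also have "\<dots> \<le> (mat_opnorm ?R)\<^sup>2 *
        (C\<^sup>2 * (vec_l2norm v)\<^sup>2 + real (Nc - 2) * (shifted_norm n ?W \<Psi> v x)\<^sup>2)"
    proof (intro mult_left_mono)
      have "Re ((?G *\<^sub>v w j) \<bullet>c w j) = (shifted_norm n ?W \<Psi> v x)\<^sup>2" if "j < Nc - 2" for j
      proof -
        \<comment> \<open>Moving adj(\<Phi>^k) across the scalar product turns the F-type cost of
          \<open>w j\<close> into the quadratic form of the shifted Gramian at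
          \<open>y j\<close>.\<close>
        have "(?G *\<^sub>v w j) \<bullet>c w j = (?P *\<^sub>v (?G *\<^sub>v (mat_adjoint ?P *\<^sub>v y j))) \<bullet>c y j"
          using cscalar_mult_mat_vec[OF P mult_mat_vec_carrier[OF Gc Py] y, of j j] that
          by (simp add: w_def)
        then show ?thesis
          using quad[of j] unfolding power_gram_shift_mult_vec[OF \<Phi> y, symmetric] by simp
      qed
      moreover have "(?G *\<^sub>v w (Nc - 2)) \<bullet>c w (Nc - 2) = 0"
        using mult_mat_vec_carrier[OF Gc zero_carrier_vec] by (simp add: w_def)
      ultimately have "(\<Sum>j<Nc - 1. Re ((?G *\<^sub>v w j) \<bullet>c w j)) =
          real (Nc - 2) * (shifted_norm n ?W \<Psi> v x)\<^sup>2"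
        unfolding N1 sum.lessThan_Suc by simp
      moreover have "(vec_l2norm f0)\<^sup>2 \<le> C\<^sup>2 * (vec_l2norm v)\<^sup>2"
        using C[OF cv[of 1]] power_mono[of "vec_l2norm f0" "C * vec_l2norm v" 2]
        by (simp add: f0_def c_def vec_l2norm_cis_smult power_mult_distrib)
      ultimately show "(vec_l2norm r)\<^sup>2 \<le>
          C\<^sup>2 * (vec_l2norm v)\<^sup>2 + real (Nc - 2) * (shifted_norm n ?W \<Psi> v x)\<^sup>2"
        unfolding nr by linarith
    qed simp
    finally have main: "real (Nc - 2) * (vec_l2norm ((\<Psi> - ?P) *\<^sub>v v))\<^sup>2 \<le> (mat_opnorm ?R)\<^sup>2 *
        (C\<^sup>2 * (vec_l2norm v)\<^sup>2 + real (Nc - 2) * (shifted_norm n ?W \<Psi> v x)\<^sup>2)" .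
    have small: "C\<^sup>2 \<le> real (Nc - 2) * (C * (2 / sqrt (real Nc + 1)))\<^sup>2"
      using Nc by (intro two_div_sqrt_power2) auto
    show ?thesis
      by (rule le_of_mean_square_le[OF _ _ _ _ _ main small])
        (use Nc in \<open>auto simp: mat_opnorm_nonneg shifted_norm_def C_def\<close>)
  qed
  moreover have "C > 0" by (simp add: C_def)
  ultimately show ?thesis by blast
qed

theorem theorem2:
  fixes n k :: nat and \<Phi> \<Psi> :: "complex mat"
  assumes "k \<ge> 1" and "\<Phi> \<in> carrier_mat n n" and "\<Psi> \<in> carrier_mat n n"
  shows "\<exists>\<epsilon>\<^sub>F \<epsilon>\<^sub>F\<^sub>C\<^sub>F :: nat \<Rightarrow> real.
    (\<forall>Nc. \<epsilon>\<^sub>F Nc > 0) \<and> (\<forall>Nc. \<epsilon>\<^sub>F\<^sub>C\<^sub>F Nc > 0) \<and>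
    \<epsilon>\<^sub>F \<in> O(\<lambda>Nc. 1 / sqrt (real Nc)) \<and> \<epsilon>\<^sub>F\<^sub>C\<^sub>F \<in> O(\<lambda>Nc. 1 / sqrt (real Nc)) \<and>
    (\<forall>Nc \<ge> 3.
      (\<exists>\<phi>\<^sub>F. is_minimum \<phi>\<^sub>F (tap_constants n k (W_F k \<Phi>) \<Phi> \<Psi> (\<epsilon>\<^sub>F Nc)) \<and>
         mat_opnorm (R_F n Nc k \<Phi> \<Psi>) \<ge> \<phi>\<^sub>F) \<and>
      (invertible_mat (W_FCF k \<Phi>) \<longrightarrow>
        (\<exists>\<phi>\<^sub>F\<^sub>C\<^sub>F. is_minimum \<phi>\<^sub>F\<^sub>C\<^sub>F (tap_constants n k (W_FCF k \<Phi>) \<Phi> \<Psi> (\<epsilon>\<^sub>F\<^sub>C\<^sub>F Nc)) \<and>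
           mat_opnorm (R_FCF n Nc k \<Phi> \<Psi>) \<ge> \<phi>\<^sub>F\<^sub>C\<^sub>F)))"
proof -
  note k = assms(1) and \<Phi> = assms(2) and \<Psi> = assms(3)
  obtain C where C: "C > 0" and FCF: "\<And>Nc v x. invertible_mat (W_FCF k \<Phi>) \<Longrightarrow> Nc \<ge> 3 \<Longrightarrow>
      v \<in> carrier_vec n \<Longrightarrow>
      vec_l2norm ((\<Psi> - \<Phi> ^\<^sub>m k) *\<^sub>v v) \<le> mat_opnorm (R_FCF n Nc k \<Phi> \<Psi>) *
        (shifted_norm n (W_FCF k \<Phi>) \<Psi> v x + C * (2 / sqrt (real Nc + 1)) * vec_l2norm v)"
  proof (cases "invertible_mat (W_FCF k \<Phi>)")
    case True
    then show ?thesis using that FCF_bound[OF k \<Phi> True] \<Psi> by blast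
  next
    case False
    \<comment> \<open>Here the FCF claim is vacuous, but a positive function of the right order is
      still owed; any positive constant serves.\<close>
    then show ?thesis using that[of 1] by simp
  qed
  define \<epsilon> where "\<epsilon> C Nc = C * (2 / sqrt (real Nc + 1))" for C :: real and Nc :: nat
  have pos: "\<epsilon> D Nc > 0" if "D > 0" for D Nc using that by (simp add: \<epsilon>_def)
  have bigo: "\<epsilon> D \<in> O(\<lambda>Nc. 1 / sqrt (real Nc))" for D
    unfolding \<epsilon>_def[abs_def] by (rule two_div_sqrt_bigo)
  have W_F: "W_F k \<Phi> \<in> carrier_mat n n"
    using psd_sqrt_psd[OF psd_power_gram[OF \<Phi>]] by (auto simp: W_F_def psd_mat_def)
  have F: "\<exists>\<phi>. is_minimum \<phi> (tap_constants n k (W_F k \<Phi>) \<Phi> \<Psi> (\<epsilon> 1 Nc)) \<and>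
      mat_opnorm (R_F n Nc k \<Phi> \<Psi>) \<ge> \<phi>" if "Nc \<ge> 3" for Nc
    using F_bound[OF k \<Phi> \<Psi> that]
    by (intro tap_constants_minimum[OF mat_inv_det_nonzero(1)[OF W_F det_W_F[OF k \<Phi>]] \<Psi> mat_opnorm_nonneg])
      (simp add: \<epsilon>_def)
  have FCF': "\<exists>\<phi>. is_minimum \<phi> (tap_constants n k (W_FCF k \<Phi>) \<Phi> \<Psi> (\<epsilon> C Nc)) \<and>
      mat_opnorm (R_FCF n Nc k \<Phi> \<Psi>) \<ge> \<phi>"
    if inv: "invertible_mat (W_FCF k \<Phi>)" and Nc: "Nc \<ge> 3" for Nc
    using FCF[OF inv Nc]
    by (intro tap_constants_minimum[OF mat_inv_det_nonzero(1)[OF W_FCF_invertible[OF \<Phi> inv]] \<Psi> mat_opnorm_nonneg])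
      (simp add: \<epsilon>_def)
  show ?thesis
    using pos[of 1] pos[OF C] bigo F FCF' by (intro exI[of _ "\<epsilon> 1"] exI[of _ "\<epsilon> C"]) simp
qed

end
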